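(* If both $m$ and $n$ change sign in $]T_1,T_2[$, then $\Sigma^{*}$ contains at least one hyperbolic like curve in each of the four quadrants $\mathbb{R}^{+}\times\mathbb{R}^{+}$, $\mathbb{R}^{-}\times\mathbb{R}^{-}$, $\mathbb{R}^{+}\times\mathbb{R}^{-}$, $\mathbb{R}^{-}\times\mathbb{R}^{+}$; that is, for each quadrant $Q$ at least one of the sets $C_k^{>}\cap Q$, $C_k^{<}\cap Q$ with $k\ge 2$ is nonempty, and it is a hyperbolic like curve.
   Context: Let $T_1<T_2$ be reals and let $p,q,m,n\in C[T_1,T_2]$ be real-valued with $p>0$, $q\ge 0$ on $[T_1,T_2]$, $m\not\equiv 0$, $n\not\equiv 0$. Put $Lu:=-(p(t)u')'+q(t)u$ and $u^{\pm}:=\max\{\pm u,0\}$. For $(a,b)\in\mathbb{R}^2$ consider the problem $$(P)\qquad Lu=a\,m(t)u^{+}-b\,n(t)u^{-}\ \text{in } ]T_1,T_2[,\qquad u(T_1)=u(T_2)=0,$$ solutions being functions $u\in C^1[T_1,T_2]$ with $pu'\in C^1[T_1,T_2]$. The Fučík spectrum $\Sigma$ is the set of $(a,b)\in\mathbb{R}^2$ for which $(P)$ has a nontrivial solution. For $k\ge 1$, $C_k^{>}$ (resp. $C_k^{<}$) is the set of $(a,b)\in\mathbb{R}^2$ such that $(P)$ has a solution $u$ with exactly $k-1$ zeros in $]T_1,T_2[$ and $u'(T_1)>0$ (resp. $u'(T_1)<0$). $\Sigma^{*}$ is $\Sigma$ without the trivial lines $C_1^{>}$ and $C_1^{<}$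 (vertical lines $\{\lambda_{\pm1}^m\}\times\mathbb{R}$ and horizontal lines $\mathbb{R}\times\{\lambda_{\pm1}^n\}$, where $\lambda_{1}^m$, $\lambda_{-1}^m$ are the smallest positive and largest negative eigenvalues of $Lu=\lambda m u$, $u(T_1)=u(T_2)=0$, and similarly for $n$). A function $m$ changes sign in $]T_1,T_2[$ if both $m^{+}\not\equiv0$ and $m^{-}\not\equiv 0$ there. $\mathbb{R}^{+}=]0,+\infty[$, $\mathbb{R}^{-}=]-\infty,0[$. Hyperbolic like curve: a subset $C$ of $\mathbb{R}^{+}\times\mathbb{R}^{+}$ is a hyperbolic like curve if $C=\{(x,f(x)):x\in]\nu,+\infty[\}$ for some $\nu,\mu\ge0$ and some strictly decreasing $C^1$ function $f$ from $]\nu,+\infty[$ onto $]\mu,+\infty[$ with $f'<0$ everywhere. A subset of another quadrant is a hyperbolic like curve if its image in $\mathbb{R}^{+}\times\mathbb{R}^{+}$ under the appropriate reflection $(a,b)\mapsto(\pm a,\pm b)$ is one. *)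

theory Defs
  imports "HOL-Analysis.Analysis"
begin

text \<open>
  Derivative relative to \<open>[T1, T2]\<close>: one-sided at the endpoints, the ordinary derivative
  in the interior. The values of a function outside the interval never matter.
\<close>
definition deriv_on :: "real \<Rightarrow> real \<Rightarrow> (real \<Rightarrow> real) \<Rightarrow> real \<Rightarrow> real" where
  "deriv_on T1 T2 u t = vector_derivative u (at t within {T1..T2})"

text \<open>
  The library's \<open>C1_differentiable_on\<close> asks for two-sided derivatives, which is not the
  meaning of \<open>C\<^sup>1[T1, T2]\<close> at the endpoints.
\<close>
definition C1_closed :: "real \<Rightarrow> real \<Rightarrow> (real \<Rightarrow> real) \<Rightarrow> bool" where
  "C1_closed T1 T2 u \<longleftrightarrow>
     u differentiable_on {T1..T2} \<and> continuous_on {T1..T2} (deriv_on T1 T2 u)"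

definition fucik_solution ::
  "real \<Rightarrow> real \<Rightarrow> (real \<Rightarrow> real) \<Rightarrow> (real \<Rightarrow> real) \<Rightarrow> (real \<Rightarrow> real) \<Rightarrow> (real \<Rightarrow> real)
     \<Rightarrow> real \<Rightarrow> real \<Rightarrow> (real \<Rightarrow> real) \<Rightarrow> bool" where
  "fucik_solution T1 T2 p q m n a b u \<longleftrightarrow>
     C1_closed T1 T2 u \<and>
     C1_closed T1 T2 (\<lambda>t. p t * deriv_on T1 T2 u t) \<and>
     (\<forall>t\<in>{T1<..<T2}.
        - deriv_on T1 T2 (\<lambda>s. p s * deriv_on T1 T2 u s) t + q t * u t
          = a * m t * max (u t) 0 - b * n t * max (- u t) 0) \<and>
     u T1 = 0 \<and> u T2 = 0"

definition fucik_spectrum ::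
  "real \<Rightarrow> real \<Rightarrow> (real \<Rightarrow> real) \<Rightarrow> (real \<Rightarrow> real) \<Rightarrow> (real \<Rightarrow> real) \<Rightarrow> (real \<Rightarrow> real)
     \<Rightarrow> (real \<times> real) set" where
  "fucik_spectrum T1 T2 p q m n =
     {(a, b). \<exists>u. fucik_solution T1 T2 p q m n a b u \<and> (\<exists>t\<in>{T1..T2}. u t \<noteq> 0)}"

definition exactly_zeros :: "real \<Rightarrow> real \<Rightarrow> nat \<Rightarrow> (real \<Rightarrow> real) \<Rightarrow> bool" where
  "exactly_zeros T1 T2 j u \<longleftrightarrow>
     finite {t\<in>{T1<..<T2}. u t = 0} \<and> card {t\<in>{T1<..<T2}. u t = 0} = j"

text \<open>\<open>C\<^sub>k\<close> with superscript \<open>>\<close> and \<open><\<close>; only \<open>k \<ge> 1\<close> is meaningful.\<close>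

definition C_gt ::
  "real \<Rightarrow> real \<Rightarrow> (real \<Rightarrow> real) \<Rightarrow> (real \<Rightarrow> real) \<Rightarrow> (real \<Rightarrow> real) \<Rightarrow> (real \<Rightarrow> real)
     \<Rightarrow> nat \<Rightarrow> (real \<times> real) set" where
  "C_gt T1 T2 p q m n k =
     {(a, b). \<exists>u. fucik_solution T1 T2 p q m n a b u \<and>
        exactly_zeros T1 T2 (k - 1) u \<and> deriv_on T1 T2 u T1 > 0}"

definition C_lt ::
  "real \<Rightarrow> real \<Rightarrow> (real \<Rightarrow> real) \<Rightarrow> (real \<Rightarrow> real) \<Rightarrow> (real \<Rightarrow> real) \<Rightarrow> (real \<Rightarrow> real)
     \<Rightarrow> nat \<Rightarrow> (real \<times> real) set" where
  "C_lt T1 T2 p q m n k =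
     {(a, b). \<exists>u. fucik_solution T1 T2 p q m n a b u \<and>
        exactly_zeros T1 T2 (k - 1) u \<and> deriv_on T1 T2 u T1 < 0}"

definition fucik_spectrum_star ::
  "real \<Rightarrow> real \<Rightarrow> (real \<Rightarrow> real) \<Rightarrow> (real \<Rightarrow> real) \<Rightarrow> (real \<Rightarrow> real) \<Rightarrow> (real \<Rightarrow> real)
     \<Rightarrow> (real \<times> real) set" where
  "fucik_spectrum_star T1 T2 p q m n =
     fucik_spectrum T1 T2 p q m n - (C_gt T1 T2 p q m n 1 \<union> C_lt T1 T2 p q m n 1)"

definition changes_sign :: "real \<Rightarrow> real \<Rightarrow> (real \<Rightarrow> real) \<Rightarrow> bool" where
  "changes_sign T1 T2 m \<longleftrightarrow>
     (\<exists>t\<in>{T1<..<T2}. max (m t) 0 \<noteq> 0) \<and> (\<exists>t\<in>{T1<..<T2}. max (- m t) 0 \<noteq> 0)"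

definition hyperbolic_like_pos :: "(real \<times> real) set \<Rightarrow> bool" where
  "hyperbolic_like_pos C \<longleftrightarrow>
     C \<subseteq> {0<..} \<times> {0<..} \<and>
     (\<exists>\<nu> \<mu> f. \<nu> \<ge> 0 \<and> \<mu> \<ge> 0 \<and>
        strict_antimono_on {\<nu><..} f \<and> f ` {\<nu><..} = {\<mu><..} \<and>
        f C1_differentiable_on {\<nu><..} \<and> (\<forall>x\<in>{\<nu><..}. deriv f x < 0) \<and>
        C = {(x, f x) | x. x \<in> {\<nu><..}})"

text \<open>
  The positivity built into \<open>hyperbolic_like_pos\<close> forces \<open>(\<sigma>, \<tau>)\<close> to be the signs of
  the open quadrant containing \<open>C\<close>.
\<close>
definition hyperbolic_like :: "(real \<times> real) set \<Rightarrow> bool" where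
  "hyperbolic_like C \<longleftrightarrow>
     (\<exists>\<sigma>\<in>{1, -1}. \<exists>\<tau>\<in>{1, -1}. hyperbolic_like_pos ((\<lambda>(a, b). (\<sigma> * a, \<tau> * b)) ` C))"

end

theory Submission
  imports Defs
begin

text \<open>
  Changing the sign of \<open>a\<close> and \<open>m\<close> together, or of \<open>b\<close> and \<open>n\<close> together, does not change the
  equation, so a curve in any quadrant is a curve in the positive quadrant for the weights
  \<open>\<plusminus>m\<close> and \<open>\<plusminus>n\<close>. Since \<open>m\<close> and \<open>n\<close> change sign, each of these weights is positive somewhere. The curve
  is always found with \<open>k = 2\<close>.

  A solution that starts positive and has a single interior zero \<open>s\<close> is positive on
  \<open>]T1, s[\<close>, where it solves \<open>Lu = a m u\<close>, and minus a positive solution of \<open>Lu = b n u\<close> on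
  \<open>]s, T2[\<close>. Conversely, two such pieces have nonzero slopes at \<open>s\<close> and can be rescaled to
  fit together. For \<open>a > 0\<close> the first piece exists exactly when \<open>a\<close> is the principal (least
  positive) eigenvalue \<open>x s\<close> of the weight \<open>m\<close> on \<open>[T1, s]\<close>, and for \<open>b > 0\<close> the second
  exactly when \<open>b\<close> is the principal eigenvalue \<open>y s\<close> of \<open>n\<close> on \<open>[s, T2]\<close>. Hence the part of
  \<open>C\<^sub>2\<close> (started positive) in the positive quadrant is \<open>{(x s, y s)}\<close>. Here \<open>s\<close> runs from the
  infimum \<open>c\<close> of the points where \<open>m\<close> is positive to the supremum \<open>d\<close> of those where \<open>n\<close> is.
  On \<open>]c, d[\<close> the function \<open>x\<close> decreases from infinity to \<open>x d\<close>, the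
  function \<open>y\<close> increases from \<open>y c\<close> to infinity, and both are \<open>C\<^sup>1\<close> with nonvanishing
  derivative; eliminating \<open>s\<close> gives a hyperbolic like curve
  (\<open>hyperbolic_like_pos_parametrized\<close>, \<open>second_curve_in_positive_quadrant\<close>). If
  \<open>c < d\<close> fails, the exchange \<open>u \<mapsto> -u\<close>, which swaps \<open>(a, m)\<close> with \<open>(b, n)\<close>, produces the curve
  from the solutions that start negative instead. Strict monotonicity of \<open>x\<close> and \<open>y\<close> also keeps the
  curve off the trivial lines, where \<open>a = x T2\<close> or \<open>b = y T1\<close>.

  The principal eigenvalue is studied by shooting. Let \<open>phi a\<close> solve \<open>Lu = a m u\<close> with
  \<open>u T1 = 0\<close> and \<open>p u' = 1\<close> at \<open>T1\<close>; then \<open>a\<close> is principal on \<open>[T1, s]\<close> when \<open>s\<close> is the first zero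
  of \<open>phi a\<close>. As \<open>m\<close> changes sign, Sturm comparison does not apply to two values of \<open>a\<close>;
  it is replaced by the Picone-type identity behind \<open>phi_comparison\<close>, which gives uniqueness and
  strict monotonicity of the eigenvalue in \<open>s\<close>. Existence (\<open>principal_exists\<close>) takes
  the least \<open>a\<close> for which \<open>phi a\<close> vanishes somewhere in \<open>]T1, s]\<close>. The derivative
  (\<open>eigval_DERIV\<close>) comes from the Wronskian of \<open>phi a\<close> and \<open>phi b\<close>, which is \<open>b - a\<close> times
  an integral of \<open>m (phi a) (phi b)\<close>.
\<close>

section \<open>Inequalities obtained from derivatives\<close>

lemma deriv_nonneg_imp_le:
  fixes f f' :: "real \<Rightarrow> real"
  assumes D: "\<And>t. t \<in> {a..b} \<Longrightarrow> (f has_real_derivative f' t) (at t within {a..b})"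
    and nonneg: "\<And>t. t \<in> {a<..<b} \<Longrightarrow> 0 \<le> f' t"
    and st: "a \<le> s" "s \<le> t" "t \<le> b"
  shows "f s \<le> f t"
proof (rule DERIV_nonneg_imp_increasing_open[OF st(2)])
  show "\<exists>y. DERIV f r :> y \<and> 0 \<le> y" if "s < r" "r < t" for r
  proof (intro exI conjI)
    have "at r within {a..b} = at r"
      using that st by (intro at_within_Icc_at) auto
    then show "DERIV f r :> f' r"
      using D[of r] that st by simp
    show "0 \<le> f' r"
      using that st by (intro nonneg) auto
  qed
  have "continuous_on {a..b} f"
    by (rule DERIV_continuous_on[OF D])
  then show "continuous_on {s..t} f"
    by (rule continuous_on_subset) (use st in auto)
qed

lemma abs_le_of_abs_deriv_le:
  fixes f f' G G' :: "real \<Rightarrow> real"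
  assumes Df: "\<And>t. t \<in> {a..b} \<Longrightarrow> (f has_real_derivative f' t) (at t within {a..b})"
    and DG: "\<And>t. t \<in> {a..b} \<Longrightarrow> (G has_real_derivative G' t) (at t within {a..b})"
    and le: "\<And>t. t \<in> {a..b} \<Longrightarrow> \<bar>f' t\<bar> \<le> G' t"
    and init: "f a = 0" "G a = 0" and t: "t \<in> {a..b}"
  shows "\<bar>f t\<bar> \<le> G t"
proof -
  have "G a - f a \<le> G t - f t"
  proof (rule deriv_nonneg_imp_le[where f = "\<lambda>t. G t - f t" and f' = "\<lambda>t. G' t - f' t" and a = a and b = b])
    show "((\<lambda>t. G t - f t) has_real_derivative G' r - f' r) (at r within {a..b})"
      if "r \<in> {a..b}" for r
      using that by (intro DERIV_diff Df DG)
    show "0 \<le> G' r - f' r" if "r \<in> {a<..<b}" for r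
      using le[of r] that by auto
  qed (use t in auto)
  moreover have "G a + f a \<le> G t + f t"
  proof (rule deriv_nonneg_imp_le[where f = "\<lambda>t. G t + f t" and f' = "\<lambda>t. G' t + f' t" and a = a and b = b])
    show "((\<lambda>t. G t + f t) has_real_derivative G' r + f' r) (at r within {a..b})"
      if "r \<in> {a..b}" for r
      using that by (intro DERIV_add Df DG)
    show "0 \<le> G' r + f' r" if "r \<in> {a<..<b}" for r
      using le[of r] that by auto
  qed (use t in auto)
  ultimately show ?thesis
    using init by auto
qed

text \<open>
  Rigidity in the comparison arguments: the energy-type functions used below are
  monotone and have the same limit at both ends of an interval, hence are constant. Limits replace values
  because a function of this kind may contain a quotient that is undefined at the ends.
\<close>
lemma nondecreasing_equal_limits_imp_deriv_0:
  fixes f f' :: "real \<Rightarrow> real"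
  assumes D: "\<And>t. t \<in> {a<..<b} \<Longrightarrow> (f has_real_derivative f' t) (at t)"
    and nonneg: "\<And>t. t \<in> {a<..<b} \<Longrightarrow> 0 \<le> f' t"
    and lim: "(f \<longlongrightarrow> l) (at_right a)" "(f \<longlongrightarrow> l) (at_left b)"
    and t: "t \<in> {a<..<b}"
  shows "f' t = 0"
proof -
  have mono: "f r \<le> f s" if "a < r" "r \<le> s" "s < b" for r s
  proof (rule DERIV_nonneg_imp_nondecreasing[OF that(2)])
    show "\<exists>y. DERIV f x :> y \<and> 0 \<le> y" if "r \<le> x" "x \<le> s" for x
      using D[of x] nonneg[of x] that \<open>a < r\<close> \<open>s < b\<close> by auto
  qed
  have const: "f r = l" if r: "r \<in> {a<..<b}" for r
  proof (rule antisym)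
    show "f r \<le> l"
    proof (rule tendsto_lowerbound[OF lim(2)])
      have "eventually (\<lambda>s. s \<in> {r<..<b}) (at_left b)"
        using r by (intro eventually_at_leftI[of r]) auto
      then show "eventually (\<lambda>s. f r \<le> f s) (at_left b)"
        by eventually_elim (use r in \<open>auto intro: mono\<close>)
    qed simp
    show "l \<le> f r"
    proof (rule tendsto_upperbound[OF lim(1)])
      have "eventually (\<lambda>s. s \<in> {a<..<r}) (at_right a)"
        using r by (intro eventually_at_rightI[of a r]) auto
      then show "eventually (\<lambda>s. f s \<le> f r) (at_right a)"
        by eventually_elim (use r in \<open>auto intro: mono\<close>)
    qed simp
  qed
  have "((\<lambda>_. l) has_real_derivative f' t) (at t)"
  proof (rule has_field_derivative_transform_within_open[OF D[OF t]])
    show "open {a<..<b}" "t \<in> {a<..<b}"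
      using t by auto
  qed (use const in auto)
  then show ?thesis
    using DERIV_unique DERIV_const by blast
qed

section \<open>Linear second-order equations as first-order systems\<close>

text \<open>
  The equation \<open>(p u')' = g u\<close> with \<open>v = p u'\<close>, the quasi-derivative. Working with the pair avoids
  differentiating \<open>p\<close>, which is only continuous.
\<close>
definition sl_pair ::
  "real \<Rightarrow> real \<Rightarrow> (real \<Rightarrow> real) \<Rightarrow> (real \<Rightarrow> real) \<Rightarrow> (real \<Rightarrow> real) \<Rightarrow> (real \<Rightarrow> real) \<Rightarrow> bool" where
  "sl_pair x y p g u v \<longleftrightarrow>
     (\<forall>t\<in>{x..y}. (u has_real_derivative v t / p t) (at t within {x..y}) \<and>
                 (v has_real_derivative g t * u t) (at t within {x..y}))"

lemma sl_pairD:
  assumes "sl_pair x y p g u v" "t \<in> {x..y}"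
  shows "(u has_real_derivative v t / p t) (at t within {x..y})"
    and "(v has_real_derivative g t * u t) (at t within {x..y})"
  using assms unfolding sl_pair_def by auto

lemma sl_pair_DERIV:
  assumes "sl_pair x y p g u v" "t \<in> {x<..<y}"
  shows "(u has_real_derivative v t / p t) (at t)"
    and "(v has_real_derivative g t * u t) (at t)"
  using sl_pairD[OF assms(1), of t] assms(2) at_within_Icc_at[of x t y] by auto

lemma sl_pair_continuous:
  assumes "sl_pair x y p g u v"
  shows "continuous_on {x..y} u" "continuous_on {x..y} v"
  using sl_pairD[OF assms] DERIV_continuous continuous_on_eq_continuous_within by blast+

lemma sl_pair_subset:
  assumes "sl_pair x y p g u v" "x \<le> x'" "y' \<le> y"
  shows "sl_pair x' y' p g u v"
proof -
  have "{x'..y'} \<subseteq> {x..y}"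
    using assms by auto
  then show ?thesis
    using assms(1) unfolding sl_pair_def by (meson DERIV_subset subset_iff)
qed

lemma sl_pair_diff_scale:
  assumes "sl_pair x y p g u v" "sl_pair x y p g u' v'"
  shows "sl_pair x y p g (\<lambda>t. u t - c * u' t) (\<lambda>t. v t - c * v' t)"
  unfolding sl_pair_def
proof (intro ballI conjI)
  fix t assume t: "t \<in> {x..y}"
  show "((\<lambda>t. u t - c * u' t) has_real_derivative (v t - c * v' t) / p t) (at t within {x..y})"
    by (rule derivative_eq_intros sl_pairD[OF assms(1) t] sl_pairD[OF assms(2) t] refl)+
      (simp add: diff_divide_distrib)
  show "((\<lambda>t. v t - c * v' t) has_real_derivative g t * (u t - c * u' t)) (at t within {x..y})"
    by (rule derivative_eq_intros sl_pairD[OF assms(1) t] sl_pairD[OF assms(2) t] refl)+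
      (simp add: algebra_simps)
qed

lemma sl_pair_scale:
  assumes "sl_pair x y p g u v"
  shows "sl_pair x y p g (\<lambda>t. c * u t) (\<lambda>t. c * v t)"
  unfolding sl_pair_def
proof (intro ballI conjI)
  fix t assume t: "t \<in> {x..y}"
  show "((\<lambda>t. c * u t) has_real_derivative (c * v t) / p t) (at t within {x..y})"
    using DERIV_cmult[OF sl_pairD(1)[OF assms t], of c] by simp
  show "((\<lambda>t. c * v t) has_real_derivative g t * (c * u t)) (at t within {x..y})"
    using DERIV_cmult[OF sl_pairD(2)[OF assms t], of c] by (simp add: mult_ac)
qed

lemma sl_pair_reflect:
  assumes "sl_pair x y p g u v"
  shows "sl_pair (-y) (-x) (\<lambda>t. p (-t)) (\<lambda>t. g (-t)) (\<lambda>t. u (-t)) (\<lambda>t. - v (-t))"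
  unfolding sl_pair_def
proof (intro ballI conjI)
  have img: "uminus ` {-y..-x} = {x..y}" by simp
  fix t assume t: "t \<in> {-y..-x}"
  then have t': "-t \<in> {x..y}" by auto
  have D: "((\<lambda>t. f (-t)) has_real_derivative - d) (at t within {-y..-x})"
    if "(f has_real_derivative d) (at (-t) within {x..y})" for f d
  proof -
    have "(uminus has_real_derivative -1) (at t within {-y..-x})"
      by (auto intro!: derivative_eq_intros)
    from DERIV_image_chain[of f d, unfolded img, OF _ this] that show ?thesis
      by (simp add: o_def img)
  qed
  show "((\<lambda>t. u (-t)) has_real_derivative - v (-t) / p (-t)) (at t within {-y..-x})"
    using D[OF sl_pairD(1)[OF assms t']] by simp
  show "((\<lambda>t. - v (-t)) has_real_derivative g (-t) * u (-t)) (at t within {-y..-x})"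
    using DERIV_minus[OF D[OF sl_pairD(2)[OF assms t']]] by simp
qed

text \<open>
  Gronwall's inequality for a solution starting from zero data and driven by an error \<open>h\<close>. With \<open>h = 0\<close> it gives
  uniqueness, and with \<open>h\<close> proportional to a change of the parameter it gives continuous dependence.
\<close>
lemma perturbation_bound:
  fixes du dv p g h :: "real \<Rightarrow> real"
  assumes D1: "\<And>t. t \<in> {a..b} \<Longrightarrow> (du has_real_derivative dv t / p t) (at t within {a..b})"
    and D2: "\<And>t. t \<in> {a..b} \<Longrightarrow> (dv has_real_derivative g t * du t + h t) (at t within {a..b})"
    and M: "\<And>t. t \<in> {a..b} \<Longrightarrow> \<bar>1 / p t\<bar> \<le> M" "\<And>t. t \<in> {a..b} \<Longrightarrow> \<bar>g t\<bar> \<le> M"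
    and h: "\<And>t. t \<in> {a..b} \<Longrightarrow> \<bar>h t\<bar> \<le> \<epsilon>"
    and init: "du a = 0" "dv a = 0" and t: "t \<in> {a..b}"
  shows "(du t)\<^sup>2 + (dv t)\<^sup>2 \<le> \<epsilon>\<^sup>2 * exp ((2 * M + 1) * (b - a))"
proof -
  define K where "K = 2 * M + 1"
  define E where "E t = (du t)\<^sup>2 + (dv t)\<^sup>2" for t
  define E' where "E' t = 2 * du t * dv t * (1 / p t + g t) + 2 * dv t * h t" for t
  have "0 \<le> M"
    using M(1)[OF t] by linarith
  then have K: "1 \<le> K"
    by (simp add: K_def)
  have E'_le: "E' r \<le> K * E r + \<epsilon>\<^sup>2" if r: "r \<in> {a..b}" for r
  proof -
    have "2 * du r * dv r * (1 / p r + g r) \<le> \<bar>2 * du r * dv r\<bar> * \<bar>1 / p r + g r\<bar>"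
      by (metis abs_ge_self abs_mult)
    also have "\<dots> \<le> E r * (2 * M)"
    proof (rule mult_mono)
      show "\<bar>2 * du r * dv r\<bar> \<le> E r"
        using zero_le_power2[of "du r - dv r"] zero_le_power2[of "du r + dv r"]
        by (auto simp: E_def abs_le_iff power2_eq_square algebra_simps)
      show "\<bar>1 / p r + g r\<bar> \<le> 2 * M"
        using M(1)[OF r] M(2)[OF r] by linarith
    qed (auto simp: E_def)
    finally have 1: "2 * du r * dv r * (1 / p r + g r) \<le> E r * (2 * M)" .
    have "2 * dv r * h r \<le> (dv r)\<^sup>2 + (h r)\<^sup>2"
      using zero_le_power2[of "dv r - h r"] by (simp add: power2_eq_square algebra_simps)
    also have "(h r)\<^sup>2 \<le> \<epsilon>\<^sup>2"
      using h[OF r] abs_le_square_iff[of "h r" \<epsilon>] by linarith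
    finally have 2: "2 * dv r * h r \<le> E r + \<epsilon>\<^sup>2"
      using zero_le_power2[of "du r"] unfolding E_def by linarith
    show ?thesis
      using 1 2 unfolding E'_def K_def by (simp add: algebra_simps)
  qed
  \<comment> \<open>The differential inequality \<open>E' \<le> K E + \<epsilon>\<^sup>2\<close> with \<open>K \<ge> 1\<close> makes \<open>(E + \<epsilon>\<^sup>2) e\<^bsup>-K(t-a)\<^esup>\<close> nonincreasing.\<close>
  define F where "F t = - ((E t + \<epsilon>\<^sup>2) * exp (- K * (t - a)))" for t
  have "F a \<le> F t"
  proof (rule deriv_nonneg_imp_le[where f = F and f' = "\<lambda>t. (K * E t + K * \<epsilon>\<^sup>2 - E' t) * exp (- K * (t - a))"
        and a = a and b = b])
    fix r assume r: "r \<in> {a..b}"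
    have DE: "(E has_real_derivative E' r) (at r within {a..b})"
      unfolding E_def E'_def
      by (rule derivative_eq_intros D1[OF r] D2[OF r] refl)+ (simp add: algebra_simps)
    show "(F has_real_derivative (K * E r + K * \<epsilon>\<^sup>2 - E' r) * exp (- K * (r - a))) (at r within {a..b})"
      unfolding F_def
      by (rule derivative_eq_intros DE refl)+ (simp add: algebra_simps)
  next
    fix r assume r: "r \<in> {a<..<b}"
    have "\<epsilon>\<^sup>2 \<le> K * \<epsilon>\<^sup>2"
      using K by (simp add: mult_le_cancel_right1)
    then have "0 \<le> K * E r + K * \<epsilon>\<^sup>2 - E' r"
      using E'_le[of r] r by auto
    then show "0 \<le> (K * E r + K * \<epsilon>\<^sup>2 - E' r) * exp (- K * (r - a))"
      by simp
  qed (use t in auto)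
  then have "(E t + \<epsilon>\<^sup>2) * exp (- K * (t - a)) \<le> \<epsilon>\<^sup>2"
    by (simp add: F_def E_def init)
  then have "(E t + \<epsilon>\<^sup>2) * exp (- K * (t - a)) * exp (K * (t - a)) \<le> \<epsilon>\<^sup>2 * exp (K * (t - a))"
    by (intro mult_right_mono) auto
  then have "E t + \<epsilon>\<^sup>2 \<le> \<epsilon>\<^sup>2 * exp (K * (t - a))"
    by (simp add: mult.assoc flip: exp_add)
  also have "\<dots> \<le> \<epsilon>\<^sup>2 * exp (K * (b - a))"
    using t K by (intro mult_left_mono) auto
  finally show ?thesis
    unfolding E_def K_def using zero_le_power2[of \<epsilon>] by linarith
qed

lemma continuous_on_Icc_abs_bound:
  fixes f :: "real \<Rightarrow> real"
  assumes "continuous_on {a..b} f"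
  obtains B where "0 < B" "\<And>t. t \<in> {a..b} \<Longrightarrow> \<bar>f t\<bar> \<le> B"
proof -
  have "bounded (f ` {a..b})"
    using assms by (intro compact_imp_bounded compact_continuous_image) auto
  then obtain B where "0 < B" "\<forall>z\<in>f ` {a..b}. norm z \<le> B"
    unfolding bounded_pos by blast
  then show thesis
    by (intro that[of B]) auto
qed

lemma coefficient_bound:
  fixes p g :: "real \<Rightarrow> real"
  assumes "continuous_on {a..b} p" "continuous_on {a..b} g" "\<And>t. t \<in> {a..b} \<Longrightarrow> 0 < p t"
  obtains M where "0 < M" "\<And>t. t \<in> {a..b} \<Longrightarrow> \<bar>1 / p t\<bar> \<le> M" "\<And>t. t \<in> {a..b} \<Longrightarrow> \<bar>g t\<bar> \<le> M"
proof -
  have "continuous_on {a..b} (\<lambda>t. 1 / p t)"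
    using assms(1,3) by (intro continuous_intros) force+
  then obtain M1 where M1: "0 < M1" "\<And>t. t \<in> {a..b} \<Longrightarrow> \<bar>1 / p t\<bar> \<le> M1"
    using continuous_on_Icc_abs_bound by metis
  obtain M2 where M2: "0 < M2" "\<And>t. t \<in> {a..b} \<Longrightarrow> \<bar>g t\<bar> \<le> M2"
    using continuous_on_Icc_abs_bound[OF assms(2)] by metis
  show thesis
  proof (rule that[of "max M1 M2"])
    show "0 < max M1 M2" using M1 by auto
    show "\<bar>1 / p t\<bar> \<le> max M1 M2" "\<bar>g t\<bar> \<le> max M1 M2" if "t \<in> {a..b}" for t
      using M1(2)[OF that] M2(2)[OF that] by auto
  qed
qed

lemma sl_pair_unique_right:
  assumes sl: "sl_pair x y p g u v"
    and cont: "continuous_on {x..y} p" "continuous_on {x..y} g"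
    and pos: "\<And>t. t \<in> {x..y} \<Longrightarrow> 0 < p t"
    and init: "u x = 0" "v x = 0" and t: "t \<in> {x..y}"
  shows "u t = 0 \<and> v t = 0"
proof -
  obtain M where M: "\<And>t. t \<in> {x..y} \<Longrightarrow> \<bar>1 / p t\<bar> \<le> M" "\<And>t. t \<in> {x..y} \<Longrightarrow> \<bar>g t\<bar> \<le> M"
    using coefficient_bound[OF cont pos] by metis
  have "(u t)\<^sup>2 + (v t)\<^sup>2 \<le> 0\<^sup>2 * exp ((2 * M + 1) * (y - x))"
    by (rule perturbation_bound[where p = p and g = g and h = "\<lambda>_. 0"])
      (use sl_pairD[OF sl] M init t in auto)
  then show ?thesis
    by (simp add: sum_power2_le_zero_iff)
qed

text \<open>
  Uniqueness for data at any point \<open>s\<close>: to the right of \<open>s\<close> directly, to the left by the reflection \<open>t \<mapsto> -t\<close>.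
\<close>
lemma sl_pair_unique:
  assumes sl: "sl_pair x y p g u v"
    and cont: "continuous_on {x..y} p" "continuous_on {x..y} g"
    and pos: "\<And>t. t \<in> {x..y} \<Longrightarrow> 0 < p t"
    and s: "s \<in> {x..y}" "u s = 0" "v s = 0" and t: "t \<in> {x..y}"
  shows "u t = 0 \<and> v t = 0"
proof (cases "s \<le> t")
  case True
  show ?thesis
  proof (rule sl_pair_unique_right[of s y p g u v])
    show "sl_pair s y p g u v"
      using s by (intro sl_pair_subset[OF sl]) auto
    show "continuous_on {s..y} p" "continuous_on {s..y} g"
      using s by (auto intro: continuous_on_subset[OF cont(1)] continuous_on_subset[OF cont(2)])
  qed (use s t True pos in auto)
next
  case False
  have refl: "continuous_on {-s..-x} (\<lambda>t. f (-t))" if "continuous_on {x..y} f" for f :: "real \<Rightarrow> real"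
    using s by (intro continuous_on_compose2[OF that] continuous_intros) auto
  have "u (- (- t)) = 0 \<and> - v (- (- t)) = 0"
  proof (rule sl_pair_unique_right[of "-s" "-x" "\<lambda>t. p (-t)" "\<lambda>t. g (-t)" "\<lambda>t. u (-t)" "\<lambda>t. - v (-t)"])
    show "sl_pair (-s) (-x) (\<lambda>t. p (-t)) (\<lambda>t. g (-t)) (\<lambda>t. u (-t)) (\<lambda>t. - v (-t))"
      using s by (intro sl_pair_reflect sl_pair_subset[OF sl]) auto
    show "continuous_on {-s..-x} (\<lambda>t. p (-t))" "continuous_on {-s..-x} (\<lambda>t. g (-t))"
      by (rule refl[OF cont(1)], rule refl[OF cont(2)])
  qed (use s t False pos in auto)
  then show ?thesis by simp
qed

text \<open>
  Terms of the Picard series of the initial value problem \<open>u x = 0\<close>, \<open>v x = 1\<close>, not its partial sums: by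
  linearity the solution is the sum of all terms.
\<close>
primrec picard ::
  "real \<Rightarrow> (real \<Rightarrow> real) \<Rightarrow> (real \<Rightarrow> real) \<Rightarrow> nat \<Rightarrow> (real \<Rightarrow> real) \<times> (real \<Rightarrow> real)" where
  "picard x p g 0 = (\<lambda>_. 0, \<lambda>_. 1)"
| "picard x p g (Suc k) =
     (\<lambda>t. integral {x..t} (\<lambda>r. snd (picard x p g k) r / p r),
      \<lambda>t. integral {x..t} (\<lambda>r. g r * fst (picard x p g k) r))"

text \<open>
  The \<open>k\<close>-th Picard term is bounded by \<open>(M (t - x))\<^sup>k / k!\<close> when \<open>M\<close> bounds the coefficients, so the series and its
  termwise derivative converge uniformly by the Weierstrass test.
\<close>
lemma sl_pair_exists:
  fixes p g :: "real \<Rightarrow> real"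
  assumes "x \<le> y" and cont: "continuous_on {x..y} p" "continuous_on {x..y} g"
    and pos: "\<And>t. t \<in> {x..y} \<Longrightarrow> 0 < p t"
  shows "\<exists>u v. sl_pair x y p g u v \<and> u x = 0 \<and> v x = 1"
proof -
  define U where "U k = fst (picard x p g k)" for k
  define V where "V k = snd (picard x p g k)" for k
  have nz: "p t \<noteq> 0" if "t \<in> {x..y}" for t
    using pos[OF that] by simp
  have U0: "U 0 = (\<lambda>_. 0)" and V0: "V 0 = (\<lambda>_. 1)"
    by (simp_all add: U_def V_def)
  have USuc: "U (Suc k) = (\<lambda>t. integral {x..t} (\<lambda>r. V k r / p r))"
    and VSuc: "V (Suc k) = (\<lambda>t. integral {x..t} (\<lambda>r. g r * U k r))" for k
    by (simp_all add: U_def V_def)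
  have contUV: "continuous_on {x..y} (U k) \<and> continuous_on {x..y} (V k)" for k
  proof (induction k)
    case 0
    show ?case by (simp add: U0 V0)
  next
    case (Suc k)
    have "(\<lambda>r. V k r / p r) integrable_on {x..y}" "(\<lambda>r. g r * U k r) integrable_on {x..y}"
      using Suc cont nz by (auto intro!: integrable_continuous_interval continuous_intros)
    then show ?case
      unfolding USuc VSuc by (auto intro: indefinite_integral_continuous_1)
  qed
  have DU: "(U (Suc k) has_real_derivative V k t / p t) (at t within {x..y})" if "t \<in> {x..y}" for k t
    unfolding USuc using contUV[of k] cont nz that
    by (intro integral_has_real_derivative continuous_intros) auto
  have DV: "(V (Suc k) has_real_derivative g t * U k t) (at t within {x..y})" if "t \<in> {x..y}" for k t
    unfolding VSuc using contUV[of k] cont that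
    by (intro integral_has_real_derivative continuous_intros) auto
  have init: "U (Suc k) x = 0" "V (Suc k) x = 0" for k
    by (simp_all add: USuc VSuc)
  obtain M where M: "0 < M" "\<And>t. t \<in> {x..y} \<Longrightarrow> \<bar>1 / p t\<bar> \<le> M" "\<And>t. t \<in> {x..y} \<Longrightarrow> \<bar>g t\<bar> \<le> M"
    using coefficient_bound[OF cont pos] by metis
  have bound: "\<bar>U k t\<bar> \<le> (M * (t - x)) ^ k / fact k \<and> \<bar>V k t\<bar> \<le> (M * (t - x)) ^ k / fact k"
    if "t \<in> {x..y}" for k t
    using that
  proof (induction k arbitrary: t)
    case 0
    show ?case by (simp add: U0 V0)
  next
    case (Suc k)
    define G where "G r = (M * (r - x)) ^ Suc k / fact (Suc k)" for r
    have DG: "(G has_real_derivative M * ((M * (r - x)) ^ k / fact k)) (at r within {x..y})" for r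
    proof -
      have "((\<lambda>r. (M * (r - x)) ^ Suc k) has_real_derivative real (Suc k) * M * (M * (r - x)) ^ k)
              (at r within {x..y})"
        by (rule derivative_eq_intros refl)+ simp
      from DERIV_cdivide[OF this, of "fact (Suc k)"] show ?thesis
        unfolding G_def fact_Suc by (simp del: of_nat_Suc power_Suc)
    qed
    have G0: "G x = 0" by (simp add: G_def)
    have "\<bar>U (Suc k) t\<bar> \<le> G t"
    proof (rule abs_le_of_abs_deriv_le[OF DU[of _ k] DG])
      fix r assume r: "r \<in> {x..y}"
      have "\<bar>V k r / p r\<bar> = \<bar>1 / p r\<bar> * \<bar>V k r\<bar>"
        by (simp add: abs_mult[symmetric])
      also have "\<dots> \<le> M * ((M * (r - x)) ^ k / fact k)"
        using M(2)[OF r] Suc.IH[OF r] M(1) by (intro mult_mono) auto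
      finally show "\<bar>V k r / p r\<bar> \<le> M * ((M * (r - x)) ^ k / fact k)" .
    qed (use init G0 Suc.prems in auto)
    moreover have "\<bar>V (Suc k) t\<bar> \<le> G t"
    proof (rule abs_le_of_abs_deriv_le[OF DV[of _ k] DG])
      fix r assume r: "r \<in> {x..y}"
      show "\<bar>g r * U k r\<bar> \<le> M * ((M * (r - x)) ^ k / fact k)"
        unfolding abs_mult using M(3)[OF r] Suc.IH[OF r] M(1) by (intro mult_mono) auto
    qed (use init G0 Suc.prems in auto)
    ultimately show ?case
      by (simp add: G_def)
  qed
  define c where "c k = (M * (y - x)) ^ k / fact k" for k
  have sc: "summable c"
    unfolding c_def using summable_exp[of "M * (y - x)"] by (simp add: divide_inverse mult.commute)
  have bc: "\<bar>U k t\<bar> \<le> c k" "\<bar>V k t\<bar> \<le> c k" if t: "t \<in> {x..y}" for k t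
  proof -
    have "(M * (t - x)) ^ k / fact k \<le> c k"
      unfolding c_def using t M(1) by (intro divide_right_mono power_mono mult_left_mono) auto
    then show "\<bar>U k t\<bar> \<le> c k" "\<bar>V k t\<bar> \<le> c k"
      using bound[OF t, of k] by auto
  qed
  have ulU: "uniform_limit {x..y} (\<lambda>n t. \<Sum>i<n. V i t / p t) (\<lambda>t. \<Sum>i. V i t / p t) sequentially"
  proof (rule Weierstrass_m_test)
    show "norm (V n t / p t) \<le> M * c n" if "t \<in> {x..y}" for n t
    proof -
      have "norm (V n t / p t) = \<bar>1 / p t\<bar> * \<bar>V n t\<bar>"
        by (simp add: abs_mult[symmetric])
      also have "\<dots> \<le> M * c n"
        using M(1) M(2)[OF that] bc(2)[OF that, of n] by (intro mult_mono) auto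
      finally show ?thesis .
    qed
  qed (use sc in \<open>rule summable_mult\<close>)
  have ulV: "uniform_limit {x..y} (\<lambda>n t. \<Sum>i<n. g t * U i t) (\<lambda>t. \<Sum>i. g t * U i t) sequentially"
  proof (rule Weierstrass_m_test)
    show "norm (g t * U n t) \<le> M * c n" if "t \<in> {x..y}" for n t
      unfolding real_norm_def abs_mult
      using M(1) M(3)[OF that] bc(1)[OF that, of n] by (intro mult_mono) auto
  qed (use sc in \<open>rule summable_mult\<close>)
  have x_in: "x \<in> {x..y}"
    using \<open>x \<le> y\<close> by simp
  obtain u where u: "\<And>t. t \<in> {x..y} \<Longrightarrow> (\<lambda>n. U (Suc n) t) sums u t"
      "\<And>t. t \<in> {x..y} \<Longrightarrow> (u has_real_derivative (\<Sum>i. V i t / p t)) (at t within {x..y})"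
    using has_field_derivative_series[OF convex_real_interval(5) DU ulU x_in] init by fastforce
  obtain w where w: "\<And>t. t \<in> {x..y} \<Longrightarrow> (\<lambda>n. V (Suc n) t) sums w t"
      "\<And>t. t \<in> {x..y} \<Longrightarrow> (w has_real_derivative (\<Sum>i. g t * U i t)) (at t within {x..y})"
    using has_field_derivative_series[OF convex_real_interval(5) DV ulV x_in] init by fastforce
  have sumU: "(\<lambda>n. U n t) sums u t" if "t \<in> {x..y}" for t
    using u(1)[OF that] by (subst (asm) sums_Suc_iff) (simp add: U0)
  have sumV: "(\<lambda>n. V n t) sums (1 + w t)" if "t \<in> {x..y}" for t
    using w(1)[OF that] by (subst (asm) sums_Suc_iff) (simp add: V0 add.commute)
  have "sl_pair x y p g u (\<lambda>t. 1 + w t)"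
    unfolding sl_pair_def
  proof (intro ballI conjI)
    fix t assume t: "t \<in> {x..y}"
    show "(u has_real_derivative (1 + w t) / p t) (at t within {x..y})"
      using u(2)[OF t] sums_unique[OF sums_divide[OF sumV[OF t]]] by simp
    show "((\<lambda>t. 1 + w t) has_real_derivative g t * u t) (at t within {x..y})"
      using DERIV_add[OF DERIV_const w(2)[OF t], of 1] sums_unique[OF sums_mult[OF sumU[OF t]]] by simp
  qed
  moreover have "u x = 0" "w x = 0"
    using sums_unique[OF u(1)[of x]] sums_unique[OF w(1)[of x]] \<open>x \<le> y\<close> init by auto
  ultimately show ?thesis
    by (intro exI[of _ u] exI[of _ "\<lambda>t. 1 + w t"]) simp
qed

section \<open>The shooting solution\<close>

text \<open>
  Joint continuity of \<open>f a t\<close> follows from continuity in \<open>t\<close> at the single parameter \<open>a0\<close> and a Lipschitz bound in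
  \<open>a\<close> that is uniform in \<open>t\<close>.
\<close>
lemma tendsto_of_locally_lipschitz_parameter:
  fixes f :: "real \<Rightarrow> real \<Rightarrow> real"
  assumes L: "\<And>a t. \<bar>a - a0\<bar> \<le> 1 \<Longrightarrow> t \<in> S \<Longrightarrow> \<bar>f a t - f a0 t\<bar> \<le> L * \<bar>a - a0\<bar>"
    and cont: "continuous_on S (f a0)"
    and A: "(A \<longlongrightarrow> a0) F" and \<tau>: "(\<tau> \<longlongrightarrow> t0) F" "eventually (\<lambda>x. \<tau> x \<in> S) F" and t0: "t0 \<in> S"
  shows "((\<lambda>x. f (A x) (\<tau> x)) \<longlongrightarrow> f a0 t0) F"
proof -
  have near: "eventually (\<lambda>x. \<bar>A x - a0\<bar> \<le> 1) F"
    using tendstoD[OF A, of 1] by (auto simp: dist_real_def elim!: eventually_mono)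
  have "((\<lambda>x. L * \<bar>A x - a0\<bar>) \<longlongrightarrow> L * \<bar>a0 - a0\<bar>) F"
    by (intro tendsto_intros A)
  then have lim0: "((\<lambda>x. L * \<bar>A x - a0\<bar>) \<longlongrightarrow> 0) F"
    by simp
  have "((\<lambda>x. f (A x) (\<tau> x) - f a0 (\<tau> x)) \<longlongrightarrow> 0) F"
  proof (rule Lim_null_comparison[OF _ lim0])
    show "eventually (\<lambda>x. norm (f (A x) (\<tau> x) - f a0 (\<tau> x)) \<le> L * \<bar>A x - a0\<bar>) F"
      using near \<tau>(2) by eventually_elim (use L in auto)
  qed
  moreover have "((\<lambda>x. f a0 (\<tau> x)) \<longlongrightarrow> f a0 t0) F"
    by (rule continuous_on_tendsto_compose[OF cont \<tau>(1) t0 \<tau>(2)])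
  ultimately have "((\<lambda>x. (f (A x) (\<tau> x) - f a0 (\<tau> x)) + f a0 (\<tau> x)) \<longlongrightarrow> 0 + f a0 t0) F"
    by (rule tendsto_add)
  then show ?thesis by simp
qed

lemma tendsto_quotient_of_zeros:
  fixes f g :: "real \<Rightarrow> real"
  assumes "(f has_real_derivative f') (at t within S)" "(g has_real_derivative g') (at t within S)"
    and "f t = 0" "g t = 0" "g' \<noteq> 0"
  shows "((\<lambda>r. f r / g r) \<longlongrightarrow> f' / g') (at t within S)"
proof -
  have "((\<lambda>r. ((f r - f t) / (r - t)) / ((g r - g t) / (r - t))) \<longlongrightarrow> f' / g') (at t within S)"
    using assms by (intro tendsto_divide) (auto simp: has_field_derivative_iff)
  then show ?thesis
  proof (rule Lim_transform_eventually)
    show "eventually (\<lambda>r. ((f r - f t) / (r - t)) / ((g r - g t) / (r - t)) = f r / g r) (at t within S)"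
      using assms(3,4) by (auto simp: eventually_at_filter divide_simps)
  qed
qed

locale sturm_liouville =
  fixes T1 T2 :: real and p q m :: "real \<Rightarrow> real"
  assumes T: "T1 < T2"
    and cont_p: "continuous_on {T1..T2} p" and cont_q: "continuous_on {T1..T2} q"
    and cont_m: "continuous_on {T1..T2} m"
    and p_pos: "\<And>t. t \<in> {T1..T2} \<Longrightarrow> 0 < p t" and q_nonneg: "\<And>t. t \<in> {T1..T2} \<Longrightarrow> 0 \<le> q t"
begin

lemma cont_coeff: "continuous_on {T1..T2} (\<lambda>t. q t - a * m t)"
  by (intro continuous_intros cont_q cont_m)

text \<open>
  Choice is harmless here: the initial data determine the pair on \<open>[T1, T2]\<close>, and nothing is used outside.
\<close>
definition ivp :: "real \<Rightarrow> (real \<Rightarrow> real) \<times> (real \<Rightarrow> real)" where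
  "ivp a = (SOME (u, v). sl_pair T1 T2 p (\<lambda>t. q t - a * m t) u v \<and> u T1 = 0 \<and> v T1 = 1)"

definition phi :: "real \<Rightarrow> real \<Rightarrow> real" where "phi a = fst (ivp a)"
definition psi :: "real \<Rightarrow> real \<Rightarrow> real" where "psi a = snd (ivp a)"

lemma phi_psi: "sl_pair T1 T2 p (\<lambda>t. q t - a * m t) (phi a) (psi a)"
  and phi_T1: "phi a T1 = 0" and psi_T1: "psi a T1 = 1"
proof -
  obtain u v where "sl_pair T1 T2 p (\<lambda>t. q t - a * m t) u v \<and> u T1 = 0 \<and> v T1 = 1"
    using sl_pair_exists[OF less_imp_le[OF T] cont_p cont_coeff p_pos] by blast
  then have "case ivp a of (u, v) \<Rightarrow> sl_pair T1 T2 p (\<lambda>t. q t - a * m t) u v \<and> u T1 = 0 \<and> v T1 = 1"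
    unfolding ivp_def
    by (intro someI[where P = "\<lambda>(u, v). sl_pair T1 T2 p (\<lambda>t. q t - a * m t) u v \<and> u T1 = 0 \<and> v T1 = 1"
          and x = "(u, v)"]) simp
  then show "sl_pair T1 T2 p (\<lambda>t. q t - a * m t) (phi a) (psi a)" "phi a T1 = 0" "psi a T1 = 1"
    by (simp_all add: phi_def psi_def split_beta)
qed

lemmas phi_within = sl_pairD(1)[OF phi_psi] and psi_within = sl_pairD(2)[OF phi_psi]
lemmas phi_DERIV = sl_pair_DERIV(1)[OF phi_psi] and psi_DERIV = sl_pair_DERIV(2)[OF phi_psi]
lemmas cont_phi = sl_pair_continuous(1)[OF phi_psi] and cont_psi = sl_pair_continuous(2)[OF phi_psi]

text \<open>
  The solutions of \<open>Lu = a m u\<close> that vanish at \<open>T1\<close> form a line. This turns statements about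
  an arbitrary eigenfunction into statements about the zeros of \<open>phi a\<close>.
\<close>
lemma multiple_of_phi:
  assumes sl: "sl_pair T1 y p (\<lambda>t. q t - a * m t) u v" and "u T1 = 0" "y \<le> T2" and t: "t \<in> {T1..y}"
  shows "u t = v T1 * phi a t \<and> v t = v T1 * psi a t"
proof -
  have "u t - v T1 * phi a t = 0 \<and> v t - v T1 * psi a t = 0"
  proof (rule sl_pair_unique_right[where x = T1 and y = y and p = p and g = "\<lambda>t. q t - a * m t"
        and u = "\<lambda>t. u t - v T1 * phi a t" and v = "\<lambda>t. v t - v T1 * psi a t"])
    show "sl_pair T1 y p (\<lambda>t. q t - a * m t) (\<lambda>t. u t - v T1 * phi a t) (\<lambda>t. v t - v T1 * psi a t)"
      using \<open>y \<le> T2\<close> by (intro sl_pair_diff_scale sl sl_pair_subset[OF phi_psi]) auto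
    show "continuous_on {T1..y} p" "continuous_on {T1..y} (\<lambda>t. q t - a * m t)"
      using \<open>y \<le> T2\<close>
      by (auto intro: continuous_on_subset[OF cont_p] continuous_on_subset[OF cont_coeff])
  qed (use assms p_pos in \<open>auto simp: phi_T1 psi_T1\<close>)
  then show ?thesis by simp
qed

lemma phi_psi_nontrivial:
  assumes "t \<in> {T1..T2}" "phi a t = 0"
  shows "psi a t \<noteq> 0"
proof
  assume "psi a t = 0"
  then have "psi a T1 = 0"
    using sl_pair_unique[OF phi_psi cont_p cont_coeff p_pos assms(1), of a T1] assms T by auto
  then show False
    by (simp add: psi_T1)
qed

text \<open>
  The difference \<open>phi a - phi a0\<close> solves the system for \<open>a\<close>, with zero data and error term
  \<open>-(a - a0) m phi a0\<close>, so \<open>perturbation_bound\<close> applies.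
\<close>
lemma phi_psi_lipschitz:
  "\<exists>L. \<forall>a t. \<bar>a - a0\<bar> \<le> 1 \<longrightarrow> t \<in> {T1..T2} \<longrightarrow>
     \<bar>phi a t - phi a0 t\<bar> \<le> L * \<bar>a - a0\<bar> \<and> \<bar>psi a t - psi a0 t\<bar> \<le> L * \<bar>a - a0\<bar>"
proof -
  obtain P where P: "\<And>t. t \<in> {T1..T2} \<Longrightarrow> \<bar>1 / p t\<bar> \<le> P"
    using coefficient_bound[OF cont_p cont_q p_pos] by metis
  obtain Q where Q: "\<And>t. t \<in> {T1..T2} \<Longrightarrow> \<bar>q t\<bar> \<le> Q"
    using continuous_on_Icc_abs_bound[OF cont_q] by metis
  obtain B where B: "\<And>t. t \<in> {T1..T2} \<Longrightarrow> \<bar>m t\<bar> \<le> B"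
    using continuous_on_Icc_abs_bound[OF cont_m] by metis
  obtain D where D: "0 < D" "\<And>t. t \<in> {T1..T2} \<Longrightarrow> \<bar>m t * phi a0 t\<bar> \<le> D"
    using continuous_on_Icc_abs_bound[OF continuous_on_mult[OF cont_m cont_phi]] by metis
  define M where "M = max P (Q + (\<bar>a0\<bar> + 1) * B)"
  define C where "C = exp ((2 * M + 1) * (T2 - T1))"
  have "\<bar>phi a t - phi a0 t\<bar> \<le> D * sqrt C * \<bar>a - a0\<bar> \<and> \<bar>psi a t - psi a0 t\<bar> \<le> D * sqrt C * \<bar>a - a0\<bar>"
    if a: "\<bar>a - a0\<bar> \<le> 1" and t: "t \<in> {T1..T2}" for a t
  proof -
    have "(phi a t - phi a0 t)\<^sup>2 + (psi a t - psi a0 t)\<^sup>2 \<le> (D * \<bar>a - a0\<bar>)\<^sup>2 * C"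
      unfolding C_def
    proof (rule perturbation_bound[where du = "\<lambda>t. phi a t - phi a0 t" and dv = "\<lambda>t. psi a t - psi a0 t"
          and a = T1 and p = p and g = "\<lambda>t. q t - a * m t"
          and h = "\<lambda>t. - (a - a0) * (m t * phi a0 t)"])
      fix r assume r: "r \<in> {T1..T2}"
      show "((\<lambda>t. phi a t - phi a0 t) has_real_derivative (psi a r - psi a0 r) / p r) (at r within {T1..T2})"
        by (rule derivative_eq_intros phi_within r refl)+ (simp add: diff_divide_distrib)
      show "((\<lambda>t. psi a t - psi a0 t) has_real_derivative
          (q r - a * m r) * (phi a r - phi a0 r) + - (a - a0) * (m r * phi a0 r)) (at r within {T1..T2})"
        by (rule derivative_eq_intros psi_within r refl)+ (simp add: algebra_simps)
      show "\<bar>1 / p r\<bar> \<le> M"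
        using P[OF r] by (simp add: M_def)
      have "\<bar>a\<bar> * \<bar>m r\<bar> \<le> (\<bar>a0\<bar> + 1) * B"
        using a B[OF r] by (intro mult_mono) auto
      then show "\<bar>q r - a * m r\<bar> \<le> M"
        using Q[OF r] abs_triangle_ineq4[of "q r" "a * m r"] unfolding M_def abs_mult by linarith
      have "\<bar>a - a0\<bar> * \<bar>m r * phi a0 r\<bar> \<le> \<bar>a - a0\<bar> * D"
        by (intro mult_left_mono D r) auto
      then show "\<bar>- (a - a0) * (m r * phi a0 r)\<bar> \<le> D * \<bar>a - a0\<bar>"
        by (simp add: abs_mult mult_ac abs_minus_commute)
    qed (use t in \<open>auto simp: phi_T1 psi_T1\<close>)
    also have "(D * \<bar>a - a0\<bar>)\<^sup>2 * C = (D * sqrt C * \<bar>a - a0\<bar>)\<^sup>2"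
      by (simp add: power_mult_distrib C_def)
    finally have *: "(phi a t - phi a0 t)\<^sup>2 + (psi a t - psi a0 t)\<^sup>2 \<le> (D * sqrt C * \<bar>a - a0\<bar>)\<^sup>2" .
    have nn: "0 \<le> D * sqrt C * \<bar>a - a0\<bar>"
      using D(1) by (simp add: C_def)
    have "(phi a t - phi a0 t)\<^sup>2 \<le> (D * sqrt C * \<bar>a - a0\<bar>)\<^sup>2"
      "(psi a t - psi a0 t)\<^sup>2 \<le> (D * sqrt C * \<bar>a - a0\<bar>)\<^sup>2"
      using * zero_le_power2[of "phi a t - phi a0 t"] zero_le_power2[of "psi a t - psi a0 t"] by linarith+
    then show ?thesis
      using nn unfolding abs_le_square_iff[symmetric] by simp
  qed
  then show ?thesis by blast
qed

lemma phi_tendsto: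
  assumes "(A \<longlongrightarrow> a0) F" "(\<tau> \<longlongrightarrow> t0) F" "eventually (\<lambda>x. \<tau> x \<in> {T1..T2}) F" "t0 \<in> {T1..T2}"
  shows "((\<lambda>x. phi (A x) (\<tau> x)) \<longlongrightarrow> phi a0 t0) F"
    and "((\<lambda>x. psi (A x) (\<tau> x)) \<longlongrightarrow> psi a0 t0) F"
proof -
  obtain L where L: "\<And>a t. \<bar>a - a0\<bar> \<le> 1 \<Longrightarrow> t \<in> {T1..T2} \<Longrightarrow> \<bar>phi a t - phi a0 t\<bar> \<le> L * \<bar>a - a0\<bar>"
    "\<And>a t. \<bar>a - a0\<bar> \<le> 1 \<Longrightarrow> t \<in> {T1..T2} \<Longrightarrow> \<bar>psi a t - psi a0 t\<bar> \<le> L * \<bar>a - a0\<bar>"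
    using phi_psi_lipschitz by metis
  show "((\<lambda>x. phi (A x) (\<tau> x)) \<longlongrightarrow> phi a0 t0) F"
    by (rule tendsto_of_locally_lipschitz_parameter[OF L(1) cont_phi assms])
  show "((\<lambda>x. psi (A x) (\<tau> x)) \<longlongrightarrow> psi a0 t0) F"
    by (rule tendsto_of_locally_lipschitz_parameter[OF L(2) cont_psi assms])
qed

lemma phi_increasing:
  assumes "T1 \<le> r" "r < t" "t \<le> T2" "\<And>x. x \<in> {r<..<t} \<Longrightarrow> 0 < psi a x"
  shows "phi a r < phi a t"
proof (rule DERIV_pos_imp_increasing_open[OF \<open>r < t\<close>])
  show "\<exists>y. DERIV (phi a) x :> y \<and> 0 < y" if "r < x" "x < t" for x
    using phi_DERIV[of x a] assms(4)[of x] p_pos[of x] that assms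
    by (intro exI[of _ "psi a x / p x"]) auto
  show "continuous_on {r..t} (phi a)"
    by (rule continuous_on_subset[OF cont_phi]) (use assms in auto)
qed

lemma psi_initially_large:
  assumes "T1 < s" "s \<le> T2"
  obtains \<delta> where "T1 < \<delta>" "\<delta> < s" "\<And>t. t \<in> {T1..\<delta>} \<Longrightarrow> 1 / 2 < psi a t"
proof -
  have "continuous_on {T1..T2} (psi a)" by (rule cont_psi)
  then obtain d where d: "0 < d" "\<And>t. t \<in> {T1..T2} \<Longrightarrow> dist t T1 < d \<Longrightarrow> dist (psi a t) (psi a T1) < 1 / 2"
    unfolding continuous_on_iff using T
    by (metis atLeastAtMost_iff less_eq_real_def order_refl half_gt_zero zero_less_one)
  define \<delta> where "\<delta> = min (T1 + d / 2) ((T1 + s) / 2)"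
  show thesis
  proof (rule that[of \<delta>])
    show "T1 < \<delta>" "\<delta> < s"
      using assms d(1) by (auto simp: \<delta>_def min_less_iff_disj)
    show "1 / 2 < psi a t" if "t \<in> {T1..\<delta>}" for t
    proof -
      have "t \<in> {T1..T2}" "dist t T1 < d"
        using that assms d(1) by (auto simp: \<delta>_def dist_real_def)
      from d(2)[OF this] show ?thesis
        unfolding psi_T1 dist_real_def by linarith
    qed
  qed
qed

lemma phi_initially_positive:
  assumes "T1 < s" "s \<le> T2"
  obtains \<delta> where "T1 < \<delta>" "\<delta> < s" "\<And>t. t \<in> {T1<..\<delta>} \<Longrightarrow> 0 < phi a t"
proof -
  obtain \<delta> where \<delta>: "T1 < \<delta>" "\<delta> < s" "\<And>t. t \<in> {T1..\<delta>} \<Longrightarrow> 1 / 2 < psi a t"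
    using psi_initially_large[OF assms] by metis
  show thesis
  proof (rule that[OF \<delta>(1,2)])
    show "0 < phi a t" if "t \<in> {T1<..\<delta>}" for t
    proof -
      have "0 < psi a x" if "x \<in> {T1<..<t}" for x
        using \<delta>(3)[of x] that \<open>t \<in> {T1<..\<delta>}\<close> by auto
      then have "phi a T1 < phi a t"
        using that \<delta>(2) assms by (intro phi_increasing) auto
      then show ?thesis
        by (simp add: phi_T1)
    qed
  qed
qed

text \<open>
  Since \<open>phi a0\<close> vanishes at \<open>T1\<close>, uniform closeness alone does not preserve positivity there. Near \<open>T1\<close> the function
  \<open>phi a\<close> is positive because its quasi-derivative stays positive; away from \<open>T1\<close> it is bounded below.
\<close>
lemma eventually_phi_positive:
  assumes s: "T1 < s" "s \<le> T2" and pos: "\<And>t. t \<in> {T1<..s} \<Longrightarrow> 0 < phi a0 t"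
  shows "eventually (\<lambda>a. \<forall>t\<in>{T1<..s}. 0 < phi a t) (nhds a0)"
proof -
  obtain L where L: "\<And>a t. \<bar>a - a0\<bar> \<le> 1 \<Longrightarrow> t \<in> {T1..T2} \<Longrightarrow>
      \<bar>phi a t - phi a0 t\<bar> \<le> L * \<bar>a - a0\<bar> \<and> \<bar>psi a t - psi a0 t\<bar> \<le> L * \<bar>a - a0\<bar>"
    using phi_psi_lipschitz by metis
  obtain \<delta> where \<delta>: "T1 < \<delta>" "\<delta> < s" "\<And>t. t \<in> {T1..\<delta>} \<Longrightarrow> 1 / 2 < psi a0 t"
    using psi_initially_large[OF s] by metis
  have "continuous_on {\<delta>..s} (phi a0)"
    by (rule continuous_on_subset[OF cont_phi]) (use \<delta> s in auto)
  then obtain x where x: "x \<in> {\<delta>..s}" "\<And>t. t \<in> {\<delta>..s} \<Longrightarrow> phi a0 x \<le> phi a0 t"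
    using continuous_attains_inf[of "{\<delta>..s}" "phi a0"] \<delta> by auto
  have c: "0 < phi a0 x"
    using x \<delta> by (intro pos) auto
  have "((\<lambda>a. L * \<bar>a - a0\<bar>) \<longlongrightarrow> L * \<bar>a0 - a0\<bar>) (nhds a0)"
    by (intro tendsto_intros filterlim_ident)
  then have "eventually (\<lambda>a. L * \<bar>a - a0\<bar> < min (1 / 2) (phi a0 x)) (nhds a0)"
    using c by (intro order_tendstoD(2)[where y = "L * \<bar>a0 - a0\<bar>"]) auto
  moreover have "eventually (\<lambda>a. \<bar>a - a0\<bar> < 1) (nhds a0)"
    using eventually_nhds_metric[of _ a0] by (auto simp: dist_real_def intro!: exI[of _ 1])
  ultimately show ?thesis
  proof eventually_elim
    case (elim a)
    have psi: "0 < psi a t" if "t \<in> {T1..\<delta>}" for t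
      using L[of a t] \<delta>(3)[OF that] elim that s \<delta> by force
    show ?case
    proof
      fix t assume t: "t \<in> {T1<..s}"
      show "0 < phi a t"
      proof (cases "t \<le> \<delta>")
        case True
        then show ?thesis
          using phi_increasing[of T1 t a] psi t s by (force simp: phi_T1)
      next
        case False
        then show ?thesis
          using L[of a t] x(2)[of t] elim t s \<delta> by force
      qed
    qed
  qed
qed

lemma first_zero:
  assumes t: "t \<in> {T1<..T2}" "phi a t \<le> 0"
  obtains s where "s \<in> {T1<..t}" "phi a s = 0" "\<And>r. r \<in> {T1<..<s} \<Longrightarrow> 0 < phi a r"
proof -
  obtain \<delta> where \<delta>: "T1 < \<delta>" "\<delta> < t" "\<And>t. t \<in> {T1<..\<delta>} \<Longrightarrow> 0 < phi a t"
    using phi_initially_positive[of t a] t by auto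
  define Z where "Z = {r \<in> {\<delta>..t}. phi a r \<le> 0}"
  have cont: "continuous_on {\<delta>..t} (phi a)"
    by (rule continuous_on_subset[OF cont_phi]) (use \<delta> t in auto)
  have "closed Z"
    unfolding Z_def by (intro continuous_on_closed_Collect_le cont continuous_on_const closed_atLeastAtMost)
  moreover have ne: "Z \<noteq> {}" and bdd: "bdd_below Z"
    using t \<delta> by (auto simp: Z_def intro!: bdd_belowI[of _ \<delta>])
  ultimately have InfZ: "Inf Z \<in> Z"
    by (intro closed_contains_Inf)
  define s where "s = Inf Z"
  have s: "s \<in> {\<delta>..t}" "phi a s \<le> 0"
    using InfZ by (auto simp: s_def Z_def)
  have below: "0 < phi a r" if "T1 < r" "r < s" for r
  proof (rule ccontr)
    assume "\<not> 0 < phi a r"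
    then have "r \<in> Z"
      using \<delta>(3)[of r] that s by (auto simp: Z_def not_less intro: le_less_linear[THEN disjE])
    then show False
      using cInf_lower[OF _ bdd, of r] that by (simp add: s_def)
  qed
  have "phi a s = 0"
  proof (rule ccontr)
    assume "phi a s \<noteq> 0"
    then have neg: "phi a s < 0" using s by simp
    obtain x where "\<delta> \<le> x" "x \<le> s" "phi a x = 0"
      using IVT2'[of "phi a" s 0 \<delta>] neg \<delta> s continuous_on_subset[OF cont, of "{\<delta>..s}"] by force
    then show False
      using below[of x] neg \<delta>(1) by (cases "x = s") auto
  qed
  then show thesis
    using s \<delta> below by (intro that[of s]) auto
qed

lemma slope_at_first_zero:
  assumes s: "s \<in> {T1<..T2}" "phi a s = 0" and pos: "\<And>r. r \<in> {T1<..<s} \<Longrightarrow> 0 < phi a r"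
  shows "psi a s < 0"
proof (rule ccontr)
  assume "\<not> psi a s < 0"
  then have "0 < psi a s"
    using phi_psi_nontrivial[of s a] s by force
  then have "0 < psi a s / p s"
    using p_pos[of s] s by simp
  then obtain d where d: "0 < d" "\<And>h. 0 < h \<Longrightarrow> s - h \<in> {T1..T2} \<Longrightarrow> h < d \<Longrightarrow> phi a (s - h) < phi a s"
    using has_real_derivative_pos_inc_left[OF phi_within[of s a]] s by force
  define h where "h = min (d / 2) ((s - T1) / 2)"
  have "0 < h" "h < d" "s - h \<in> {T1<..<s}"
    using d(1) s by (auto simp: h_def min_def field_simps)
  then show False
    using d(2)[of h] pos[of "s - h"] s by auto
qed

lemma negative_after_first_zero:
  assumes s: "s \<in> {T1<..<T2}" "phi a s = 0" and pos: "\<And>r. r \<in> {T1<..<s} \<Longrightarrow> 0 < phi a r"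
    and y: "s < y" "y \<le> T2"
  obtains t where "t \<in> {s<..<y}" "phi a t < 0"
proof -
  have "psi a s / p s < 0"
    using slope_at_first_zero[OF _ s(2) pos] p_pos[of s] s by (auto simp: divide_neg_pos)
  then obtain d where d: "0 < d" "\<And>h. 0 < h \<Longrightarrow> s + h \<in> {T1..T2} \<Longrightarrow> h < d \<Longrightarrow> phi a s > phi a (s + h)"
    using has_real_derivative_neg_dec_right[OF phi_within[of s a]] s by force
  define h where "h = min (d / 2) ((y - s) / 2)"
  have "0 < h" "h < d" "s + h \<in> {s<..<y}"
    using d(1) y by (auto simp: h_def min_def field_simps)
  then show thesis
    using d(2)[of h] s y by (intro that[of "s + h"]) auto
qed

end

section \<open>Existence and uniqueness of the principal eigenvalue\<close>

context sturm_liouville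
begin

text \<open>
  The replacement for Sturm comparison. Write \<open>w = phi a1\<close>, \<open>u = phi a2\<close>, \<open>z\<close> and \<open>v\<close> for their
  quasi-derivatives and \<open>W = u z - w v\<close>. The function
  \<open>H = a1 W w / u + (a2 - a1) z w\<close> combines the Picone identity with the energy identity of \<open>w\<close> in such a
  way that the terms with the sign-changing weight cancel:
  \<open>H' = a1 W\<^sup>2 / (p u\<^sup>2) + (a2 - a1) (q w\<^sup>2 + z\<^sup>2 / p)\<close>. So \<open>H\<close> is nondecreasing, yet it tends to \<open>0\<close>
  at both ends. If \<open>a1 < a2\<close>, this forces \<open>z = 0\<close>, contradicting \<open>z = 1\<close> at \<open>T1\<close>.
\<close>
lemma phi_comparison:
  assumes a: "0 < a1" "a1 \<le> a2" and s: "s \<in> {T1<..T2}" "phi a1 s = 0"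
    and pos: "\<And>t. t \<in> {T1<..<s} \<Longrightarrow> 0 < phi a2 t"
  shows "a1 = a2"
proof (rule ccontr)
  assume "a1 \<noteq> a2"
  with a have less: "a1 < a2" by simp
  define w z u v where "w = phi a1" and "z = psi a1" and "u = phi a2" and "v = psi a2"
  define W where "W t = u t * z t - w t * v t" for t
  define H where "H t = a1 * (W t * (w t / u t)) + (a2 - a1) * (z t * w t)" for t
  define H' where "H' t = a1 * (W t)\<^sup>2 / (p t * (u t)\<^sup>2) + (a2 - a1) * (q t * (w t)\<^sup>2 + (z t)\<^sup>2 / p t)" for t
  have cont: "continuous_on {T1..T2} w" "continuous_on {T1..T2} z"
      "continuous_on {T1..T2} u" "continuous_on {T1..T2} v"
    unfolding w_def z_def u_def v_def by (rule cont_phi cont_psi)+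
  have at: "at_right T1 = at T1 within {T1..T2}"
    using T by (simp add: at_within_Icc_at_right)
  have lim_right: "(f \<longlongrightarrow> f T1) (at_right T1)" if "continuous_on {T1..T2} f" for f :: "real \<Rightarrow> real"
    using that T unfolding at continuous_on_def by auto
  have lim_left: "(f \<longlongrightarrow> f s) (at_left s)" if "continuous_on {T1..T2} f" for f :: "real \<Rightarrow> real"
  proof -
    have "continuous_on {T1..s} f"
      by (rule continuous_on_subset[OF that]) (use s in auto)
    then have "(f \<longlongrightarrow> f s) (at s within {T1..s})"
      using s unfolding continuous_on_def by auto
    then show ?thesis
      using s by (simp add: at_within_Icc_at_left)
  qed
  have DH: "(H has_real_derivative H' t) (at t)" if t: "t \<in> {T1<..<s}" for t
  proof -
    have "t \<in> {T1<..<T2}" using t s by auto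
    note [derivative_intros] = phi_DERIV[OF this, of a1, folded w_def z_def]
      psi_DERIV[OF this, of a1, folded w_def z_def] phi_DERIV[OF this, of a2, folded u_def v_def]
      psi_DERIV[OF this, of a2, folded u_def v_def]
    have nz: "u t \<noteq> 0" "p t \<noteq> 0"
      using pos[OF t] p_pos[of t] s t by (auto simp: u_def)
    have DW: "(W has_real_derivative (a2 - a1) * m t * u t * w t) (at t)"
      unfolding W_def by (rule derivative_eq_intros refl)+ (simp add: algebra_simps)
    have DR: "((\<lambda>t. w t / u t) has_real_derivative W t / (p t * (u t)\<^sup>2)) (at t)"
      by (rule derivative_eq_intros refl nz)+
        (use nz in \<open>simp add: W_def field_simps power2_eq_square\<close>)
    have DG: "((\<lambda>t. z t * w t) has_real_derivative (q t - a1 * m t) * (w t)\<^sup>2 + (z t)\<^sup>2 / p t) (at t)"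
      by (rule derivative_eq_intros refl)+ (simp add: power2_eq_square algebra_simps)
    show ?thesis
      unfolding H_def
      by (rule derivative_eq_intros DW DR DG refl)+
        (use nz in \<open>simp add: H'_def field_simps power2_eq_square\<close>)
  qed
  have H'_ge: "(a2 - a1) * ((z t)\<^sup>2 / p t) \<le> H' t" "0 \<le> (a2 - a1) * ((z t)\<^sup>2 / p t)"
    if t: "t \<in> {T1<..<s}" for t
    using a p_pos[of t] q_nonneg[of t] s t by (auto simp: H'_def distrib_left)
  have "(H \<longlongrightarrow> a1 * (W T1 * (1 / p T1 / (1 / p T1))) + (a2 - a1) * (z T1 * w T1)) (at_right T1)"
    unfolding H_def
  proof (intro tendsto_add
      tendsto_mult[OF tendsto_const tendsto_mult[OF lim_right[OF cont(2)] lim_right[OF cont(1)]]]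
      tendsto_mult[OF tendsto_const tendsto_mult])
    show "(W \<longlongrightarrow> W T1) (at_right T1)"
      unfolding W_def by (intro lim_right continuous_intros cont)
    show "((\<lambda>t. w t / u t) \<longlongrightarrow> 1 / p T1 / (1 / p T1)) (at_right T1)"
      unfolding at w_def u_def
      using phi_within[of T1 a1] phi_within[of T1 a2] T p_pos[of T1]
      by (intro tendsto_quotient_of_zeros) (auto simp: phi_T1 psi_T1)
  qed
  then have lim1: "(H \<longlongrightarrow> 0) (at_right T1)"
    by (simp add: W_def w_def u_def phi_T1)
  \<comment> \<open>The quotient has a finite limit at \<open>s\<close> even if \<open>u\<close> vanishes there too, and then \<open>W\<close> supplies the zero.\<close>
  have "\<exists>l. ((\<lambda>t. w t / u t) \<longlongrightarrow> l) (at_left s) \<and> W s * l = 0"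
  proof (cases "u s = 0")
    case True
    have "at_left s = at s within {T1..s}"
      using s by (simp add: at_within_Icc_at_left)
    moreover have "(phi a has_real_derivative psi a s / p s) (at s within {T1..s})" for a
      using s by (intro DERIV_subset[OF phi_within[of s a]]) auto
    moreover have "psi a2 s \<noteq> 0" "p s \<noteq> 0"
      using True phi_psi_nontrivial[of s a2] p_pos[of s] s by (auto simp: u_def)
    ultimately have "((\<lambda>t. w t / u t) \<longlongrightarrow> z s / p s / (v s / p s)) (at_left s)"
      using True s unfolding w_def u_def z_def v_def
      by (intro tendsto_quotient_of_zeros[where t = s and S = "{T1..s}", folded \<open>at_left s = _\<close>]) auto
    moreover have "W s = 0"
      using True s by (simp add: W_def w_def)
    ultimately show ?thesis by auto
  next
    case False
    then have "((\<lambda>t. w t / u t) \<longlongrightarrow> w s / u s) (at_left s)"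
      by (intro tendsto_divide lim_left cont)
    then show ?thesis
      using s by (intro exI[of _ "w s / u s"]) (auto simp: w_def)
  qed
  then obtain l where l: "((\<lambda>t. w t / u t) \<longlongrightarrow> l) (at_left s)" "W s * l = 0" by blast
  have "(H \<longlongrightarrow> a1 * (W s * l) + (a2 - a1) * (z s * w s)) (at_left s)"
    unfolding H_def
  proof (intro tendsto_add tendsto_mult[OF tendsto_const tendsto_mult[OF _ l(1)]]
      tendsto_mult[OF tendsto_const tendsto_mult[OF lim_left[OF cont(2)] lim_left[OF cont(1)]]])
    show "(W \<longlongrightarrow> W s) (at_left s)"
      unfolding W_def by (intro lim_left continuous_intros cont)
  qed
  then have lim2: "(H \<longlongrightarrow> 0) (at_left s)"
    using s by (simp add: l w_def)
  have z0: "z t = 0" if t: "t \<in> {T1<..<s}" for t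
  proof -
    have "H' t = 0"
    proof (rule nondecreasing_equal_limits_imp_deriv_0[OF DH _ lim1 lim2 t])
      show "0 \<le> H' r" if "r \<in> {T1<..<s}" for r
        using H'_ge[OF that] by linarith
    qed
    then have "(a2 - a1) * ((z t)\<^sup>2 / p t) = 0"
      using H'_ge[OF t] by linarith
    then show ?thesis
      using less p_pos[of t] s t by auto
  qed
  obtain \<delta> where \<delta>: "T1 < \<delta>" "\<delta> < s" "\<And>t. t \<in> {T1..\<delta>} \<Longrightarrow> 1 / 2 < z t"
    unfolding z_def using psi_initially_large[of s a1] s by auto
  then have "1 / 2 < z \<delta>" "z \<delta> = 0"
    using z0[of \<delta>] \<delta>(3)[of \<delta>] \<delta>(1,2) by simp_all
  then show False by simp
qed

text \<open>
  Let \<open>p \<le> P\<close> and \<open>q \<le> Q\<close>. On an interval \<open>[c, e]\<close> where \<open>m \<ge> \<mu> > 0\<close>, the Riccati variable \<open>r = p u' / u\<close> of a positive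
  solution satisfies \<open>r' \<le> -(P \<omega>\<^sup>2 + r\<^sup>2 / P)\<close> with \<open>P \<omega>\<^sup>2 = a \<mu> - Q\<close>. Then
  \<open>arctan (r / (P \<omega>)) + \<omega> t\<close> is nonincreasing, and as \<open>arctan\<close> varies by less than \<open>\<pi>\<close>,
  positivity fails once \<open>\<omega> (e - c) > \<pi>\<close>.
\<close>
lemma phi_vanishes_for_large_parameter:
  assumes t0: "t0 \<in> {T1<..<s}" "0 < m t0" and s: "s \<le> T2"
  obtains a where "0 < a" "\<exists>t\<in>{T1<..s}. phi a t \<le> 0"
proof -
  obtain d where d: "0 < d" "\<And>t. t \<in> {T1..T2} \<Longrightarrow> dist t t0 < d \<Longrightarrow> dist (m t) (m t0) < m t0 / 2"
    using cont_m[unfolded continuous_on_iff, rule_format, of t0 "m t0 / 2"] t0 s by auto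
  define c where "c = t0"
  define e where "e = min (t0 + d / 2) ((t0 + s) / 2)"
  define \<mu> where "\<mu> = m t0 / 2"
  have ce: "T1 < c" "c < e" "e < s"
    using t0 d(1) by (auto simp: c_def e_def min_less_iff_disj)
  have \<mu>: "0 < \<mu>" "\<mu> \<le> m t" if "t \<in> {c..e}" for t
  proof -
    have "t \<in> {T1..T2}" "dist t t0 < d"
      using that ce s d(1) by (auto simp: c_def e_def dist_real_def)
    from d(2)[OF this] show "\<mu> \<le> m t"
      unfolding \<mu>_def dist_real_def by linarith
  qed (use t0 in \<open>simp add: \<mu>_def\<close>)
  obtain P where P: "0 < P" "\<And>t. t \<in> {T1..T2} \<Longrightarrow> \<bar>p t\<bar> \<le> P"
    using continuous_on_Icc_abs_bound[OF cont_p] by metis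
  obtain Q where Q: "0 < Q" "\<And>t. t \<in> {T1..T2} \<Longrightarrow> \<bar>q t\<bar> \<le> Q"
    using continuous_on_Icc_abs_bound[OF cont_q] by metis
  define \<omega> where "\<omega> = (pi + 1) / (e - c)"
  have \<omega>: "0 < \<omega>"
    using ce pi_gt_zero by (simp add: \<omega>_def add_pos_pos)
  define a where "a = (P * \<omega>\<^sup>2 + Q) / \<mu>"
  have \<mu>0: "0 < \<mu>" using \<mu>(1)[of c] ce by simp
  have a: "0 < a"
    using P(1) Q(1) \<omega> \<mu>0 by (simp add: a_def add_pos_pos)
  have "\<exists>t\<in>{T1<..s}. phi a t \<le> 0"
  proof (rule ccontr)
    assume "\<not> ?thesis"
    then have pos: "0 < phi a t" if "t \<in> {T1<..s}" for t
      using that by force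
    define r where "r t = psi a t / phi a t" for t
    define g where "g t = - (arctan (r t / (P * \<omega>)) + \<omega> * t)" for t
    define r' where "r' t = q t - a * m t - (r t)\<^sup>2 / p t" for t
    define g' where "g' t = - (r' t / (P * \<omega>) / (1 + (r t / (P * \<omega>))\<^sup>2) + \<omega>)" for t
    have "g c \<le> g e"
    proof (rule deriv_nonneg_imp_le[where f = g and f' = g' and a = c and b = e])
      fix t assume t: "t \<in> {c..e}"
      then have tT: "t \<in> {T1<..<T2}" and ts: "t \<in> {T1<..s}" using ce s by auto
      note [derivative_intros] = phi_DERIV[OF tT, of a] psi_DERIV[OF tT, of a]
      have nz: "phi a t \<noteq> 0" "p t \<noteq> 0" "P * \<omega> \<noteq> 0"
        using pos[OF ts] p_pos[of t] tT P(1) \<omega> by auto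
      have Dr: "(r has_real_derivative r' t) (at t)"
        unfolding r_def
        by (rule derivative_eq_intros refl nz)+
          (use nz in \<open>simp add: r'_def r_def field_simps power2_eq_square\<close>)
      have "(g has_real_derivative g' t) (at t)"
        unfolding g_def
        by (rule derivative_eq_intros Dr refl nz)+ (use nz in \<open>simp add: g'_def field_simps\<close>)
      then show "(g has_real_derivative g' t) (at t within {c..e})"
        by (rule has_field_derivative_at_within)
    next
      fix t assume t: "t \<in> {c<..<e}"
      then have tT: "t \<in> {T1..T2}" using ce s by auto
      have "a * \<mu> \<le> a * m t"
        using \<mu>(2)[of t] t a by simp
      then have 1: "P * \<omega>\<^sup>2 + Q \<le> a * m t"
        using \<mu>0 by (simp add: a_def)
      have "(r t)\<^sup>2 / P \<le> (r t)\<^sup>2 / p t"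
        using P(2)[OF tT] p_pos[OF tT] by (intro divide_left_mono) auto
      then have "r' t \<le> - (P * \<omega>\<^sup>2 + (r t)\<^sup>2 / P)"
        using 1 Q(2)[OF tT] unfolding r'_def by linarith
      also have "\<dots> = - (P * \<omega>\<^sup>2 * (1 + (r t / (P * \<omega>))\<^sup>2))"
        using P(1) \<omega> by (simp add: field_simps power2_eq_square)
      finally have "r' t / (P * \<omega>) \<le> - (P * \<omega>\<^sup>2 * (1 + (r t / (P * \<omega>))\<^sup>2)) / (P * \<omega>)"
        using P(1) \<omega> by (intro divide_right_mono) auto
      also have "\<dots> = - \<omega> * (1 + (r t / (P * \<omega>))\<^sup>2)"
        using P(1) \<omega> by (simp add: power2_eq_square)
      finally have "r' t / (P * \<omega>) \<le> - \<omega> * (1 + (r t / (P * \<omega>))\<^sup>2)" .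
      then have "r' t / (P * \<omega>) / (1 + (r t / (P * \<omega>))\<^sup>2) \<le> - \<omega>"
        by (subst pos_divide_le_eq) (auto simp: add_pos_nonneg)
      then show "0 \<le> g' t"
        by (simp add: g'_def)
    qed (use ce in auto)
    then have "\<omega> * (e - c) \<le> arctan (r c / (P * \<omega>)) - arctan (r e / (P * \<omega>))"
      by (simp add: g_def algebra_simps)
    also have "\<dots> < pi"
      using arctan_ubound[of "r c / (P * \<omega>)"] arctan_lbound[of "r e / (P * \<omega>)"] by linarith
    finally show False
      using ce by (simp add: \<omega>_def)
  qed
  with a show thesis by (rule that)
qed

text \<open>
  While \<open>phi a\<close> is positive, a nonnegative coefficient makes \<open>psi a\<close> nondecreasing, so the slope cannot become negative,
  as it would at a first zero.
\<close>
lemma phi_positive_of_nonneg_coefficient: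
  assumes s: "s \<in> {T1<..T2}" and nonneg: "\<And>t. t \<in> {T1<..<s} \<Longrightarrow> 0 \<le> q t - a * m t"
    and t: "t \<in> {T1<..s}"
  shows "0 < phi a t"
proof (rule ccontr)
  assume "\<not> 0 < phi a t"
  then have "t \<in> {T1<..T2}" "phi a t \<le> 0" using s t by auto
  then obtain x where x: "x \<in> {T1<..t}" "phi a x = 0" "\<And>r. r \<in> {T1<..<x} \<Longrightarrow> 0 < phi a r"
    using first_zero by blast
  have "psi a T1 \<le> psi a x"
  proof (rule deriv_nonneg_imp_le[where f = "psi a" and f' = "\<lambda>t. (q t - a * m t) * phi a t"
        and a = T1 and b = x])
    show "(psi a has_real_derivative (q r - a * m r) * phi a r) (at r within {T1..x})"
      if "r \<in> {T1..x}" for r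
      using that x s t by (intro DERIV_subset[OF psi_within]) auto
    show "0 \<le> (q r - a * m r) * phi a r" if "r \<in> {T1<..<x}" for r
      using that x s t nonneg[of r] by (intro mult_nonneg_nonneg) (auto intro: less_imp_le)
  qed (use x in auto)
  moreover have "psi a x < 0"
    using x s t by (intro slope_at_first_zero) auto
  ultimately show False
    by (simp add: psi_T1)
qed

text \<open>
  For \<open>a > 0\<close>, this says that \<open>a\<close> is an eigenvalue of the weight \<open>m\<close> on \<open>[T1, s]\<close> with a positive
  eigenfunction, that is, the least positive eigenvalue.
\<close>
definition principal :: "real \<Rightarrow> real \<Rightarrow> bool" where
  "principal a s \<longleftrightarrow> 0 < a \<and> s \<in> {T1<..T2} \<and> phi a s = 0 \<and> (\<forall>t\<in>{T1<..<s}. 0 < phi a t)"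

lemma principal_imp_weight_positive:
  assumes "principal a s"
  shows "\<exists>t\<in>{T1<..<s}. 0 < m t"
proof (rule ccontr)
  assume "\<not> ?thesis"
  then have m: "m t \<le> 0" if "t \<in> {T1<..<s}" for t using that by force
  have "0 < phi a s"
  proof (rule phi_positive_of_nonneg_coefficient[of s a])
    show "0 \<le> q t - a * m t" if "t \<in> {T1<..<s}" for t
    proof -
      have "a * m t \<le> 0"
        using m[OF that] assms by (intro mult_nonneg_nonpos) (auto simp: principal_def)
      then show ?thesis
        using q_nonneg[of t] that assms by (auto simp: principal_def)
    qed
  qed (use assms in \<open>auto simp: principal_def\<close>)
  then show False
    using assms by (simp add: principal_def)
qed

text \<open>
  Let \<open>a\<close> be the infimum of the parameters for which \<open>phi a\<close> is not positive on \<open>]T1, s]\<close>. It is attained, because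
  positivity on \<open>]T1, s]\<close> is an open condition, and it is not \<open>0\<close>, because \<open>q \<ge> 0\<close>. A first zero
  of \<open>phi a\<close> before \<open>s\<close> would be a sign change and would persist for slightly smaller parameters; so the first zero is \<open>s\<close>.
\<close>
lemma principal_exists:
  assumes s: "s \<in> {T1<..T2}" and m: "\<exists>t\<in>{T1<..<s}. 0 < m t"
  shows "\<exists>a. principal a s"
proof -
  define Z where "Z = {a. 0 < a \<and> (\<exists>t\<in>{T1<..s}. phi a t \<le> 0)}"
  have ne: "Z \<noteq> {}"
  proof -
    obtain t0 where "t0 \<in> {T1<..<s}" "0 < m t0"
      using m by blast
    then obtain b where "0 < b" "\<exists>t\<in>{T1<..s}. phi b t \<le> 0"
      using phi_vanishes_for_large_parameter[of t0 s] s by auto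
    then show ?thesis
      by (auto simp: Z_def)
  qed
  have bdd: "bdd_below Z"
    by (rule bdd_belowI[of _ 0]) (auto simp: Z_def)
  define a where "a = Inf Z"
  have "0 \<le> a"
    unfolding a_def using ne by (intro cInf_greatest) (auto simp: Z_def)
  have lower: "a \<le> b" if "b \<in> Z" for b
    unfolding a_def by (rule cInf_lower[OF that bdd])
  have "\<exists>t\<in>{T1<..s}. phi a t \<le> 0"
  proof (rule ccontr)
    assume "\<not> ?thesis"
    then have "0 < phi a t" if "t \<in> {T1<..s}" for t
      using that by (meson not_less)
    then have "eventually (\<lambda>b. \<forall>t\<in>{T1<..s}. 0 < phi b t) (nhds a)"
      using s by (intro eventually_phi_positive) auto
    then obtain d where d: "0 < d" "\<And>b. dist b a < d \<Longrightarrow> \<forall>t\<in>{T1<..s}. 0 < phi b t"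
      unfolding eventually_nhds_metric by blast
    obtain b where b: "b \<in> Z" "b < a + d"
      using cInf_less_iff[OF ne bdd, of "a + d"] d(1) unfolding a_def by auto
    then have "dist b a < d"
      using lower[OF b(1)] by (simp add: dist_real_def)
    from d(2)[OF this] have "\<not> (\<exists>t\<in>{T1<..s}. phi b t \<le> 0)"
      by (meson not_less)
    with b(1) show False
      by (simp add: Z_def)
  qed
  then obtain t where t: "t \<in> {T1<..s}" "phi a t \<le> 0" by blast
  have "t \<in> {T1<..T2}" using t s by auto
  then obtain x where x: "x \<in> {T1<..t}" "phi a x = 0" "\<And>r. r \<in> {T1<..<x} \<Longrightarrow> 0 < phi a r"
    using first_zero[OF _ t(2)] by blast
  have "a \<noteq> 0"
  proof
    assume "a = 0"
    then have "0 < phi a t"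
      using phi_positive_of_nonneg_coefficient[of s 0 t] s t q_nonneg by auto
    with t show False by simp
  qed
  with \<open>0 \<le> a\<close> have a: "0 < a" by simp
  have "x = s"
  proof (rule ccontr)
    assume "x \<noteq> s"
    then have xs: "x < s" using x t by auto
    then obtain y where y: "y \<in> {x<..<s}" "phi a y < 0"
      using negative_after_first_zero[of x a s] x s t by auto
    have "((\<lambda>b. phi b y) \<longlongrightarrow> phi a y) (at_left a)"
      using y x s by (intro phi_tendsto) (auto intro!: tendsto_intros)
    then have "eventually (\<lambda>b. phi b y < 0) (at_left a)"
      using y(2) by (rule order_tendstoD)
    moreover have "eventually (\<lambda>b. b \<in> {0<..<a}) (at_left a)"
      using a by (intro eventually_at_leftI[of 0]) auto
    ultimately have "eventually (\<lambda>b. b \<in> {0<..<a} \<and> phi b y < 0) (at_left a)"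
      by eventually_elim simp
    then obtain b where "b \<in> {0<..<a}" "phi b y < 0"
      using eventually_happens[of _ "at_left a"] by (auto simp: trivial_limit_at_left_real)
    then have "b \<in> Z"
      using y x by (auto simp: Z_def intro!: bexI[of _ y])
    from lower[OF this] \<open>b \<in> {0<..<a}\<close> show False by simp
  qed
  with a x s show ?thesis
    by (auto simp: principal_def)
qed

lemma principal_parameter_less:
  assumes "principal a1 s1" "principal a2 s2" "s1 < s2"
  shows "a2 < a1"
proof (rule ccontr)
  assume "\<not> a2 < a1"
  then have "a1 = a2"
    using assms by (intro phi_comparison[of a1 a2 s1]) (auto simp: principal_def)
  then show False
    using assms by (force simp: principal_def)
qed

lemma principal_unique:
  assumes "principal a1 s" "principal a2 s"
  shows "a1 = a2"
proof (cases "a1 \<le> a2")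
  case True
  then show ?thesis
    using assms by (intro phi_comparison[of a1 a2 s]) (auto simp: principal_def)
next
  case False
  then have "a2 = a1"
    using assms by (intro phi_comparison[of a2 a1 s]) (auto simp: principal_def)
  then show ?thesis ..
qed

text \<open>
  The first zero moves to the left as the parameter grows, so every parameter above a principal eigenvalue is
  itself principal on a shorter interval. This makes the range of the eigenvalue function an interval.
\<close>
lemma principal_of_larger_parameter:
  assumes "principal a0 s0" "a0 < a"
  obtains s where "s \<in> {T1<..<s0}" "principal a s"
proof -
  have "\<not> (\<forall>t\<in>{T1<..<s0}. 0 < phi a t)"
  proof
    assume "\<forall>t\<in>{T1<..<s0}. 0 < phi a t"
    then have "a0 = a"
      using assms by (intro phi_comparison[of a0 a s0]) (auto simp: principal_def)
    with assms show False by simp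
  qed
  then obtain t where t: "t \<in> {T1<..<s0}" "phi a t \<le> 0"
    by (meson not_less)
  have "t \<in> {T1<..T2}" using t assms by (auto simp: principal_def)
  then obtain s where "s \<in> {T1<..t}" "phi a s = 0" "\<And>r. r \<in> {T1<..<s} \<Longrightarrow> 0 < phi a r"
    using first_zero[OF _ t(2)] by blast
  then show thesis
    using t assms by (intro that[of s]) (auto simp: principal_def)
qed

end

section \<open>The principal eigenvalue as a function of the right endpoint\<close>

definition positive_solution ::
  "real \<Rightarrow> real \<Rightarrow> (real \<Rightarrow> real) \<Rightarrow> (real \<Rightarrow> real) \<Rightarrow> bool" where
  "positive_solution x y p g \<longleftrightarrow>
     (\<exists>u v. sl_pair x y p g u v \<and> u x = 0 \<and> u y = 0 \<and> (\<forall>t\<in>{x<..<y}. 0 < u t))"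

text \<open>
  Reflection turns intervals \<open>[s, T2]\<close> with a moving left end into intervals with a moving right end, so a single
  eigenvalue theory covers both pieces of a solution.
\<close>
lemma positive_solution_reflect:
  assumes "positive_solution x y p g"
  shows "positive_solution (-y) (-x) (\<lambda>t. p (-t)) (\<lambda>t. g (-t))"
proof -
  obtain u v where uv: "sl_pair x y p g u v" "u x = 0" "u y = 0" "\<forall>t\<in>{x<..<y}. 0 < u t"
    using assms unfolding positive_solution_def by blast
  then show ?thesis
    unfolding positive_solution_def using sl_pair_reflect[OF uv(1)]
    by (intro exI[of _ "\<lambda>t. u (-t)"] exI[of _ "\<lambda>t. - v (-t)"]) auto
qed

lemma positive_solution_reflect_iff:
  "positive_solution x y p g \<longleftrightarrow> positive_solution (-y) (-x) (\<lambda>t. p (-t)) (\<lambda>t. g (-t))"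
  using positive_solution_reflect[of x y p g]
    positive_solution_reflect[of "-y" "-x" "\<lambda>t. p (-t)" "\<lambda>t. g (-t)"] by auto

context sturm_liouville
begin

lemma positive_solution_iff_principal:
  assumes s: "s \<in> {T1<..T2}" and a: "0 < a"
  shows "positive_solution T1 s p (\<lambda>t. q t - a * m t) \<longleftrightarrow> principal a s"
proof
  assume "positive_solution T1 s p (\<lambda>t. q t - a * m t)"
  then obtain u v where uv: "sl_pair T1 s p (\<lambda>t. q t - a * m t) u v" "u T1 = 0" "u s = 0"
    "\<forall>t\<in>{T1<..<s}. 0 < u t"
    unfolding positive_solution_def by blast
  have u: "u t = v T1 * phi a t" if "t \<in> {T1..s}" for t
    using multiple_of_phi[OF uv(1,2) _ that] s by auto
  obtain \<delta> where \<delta>: "T1 < \<delta>" "\<delta> < s" "\<And>t. t \<in> {T1<..\<delta>} \<Longrightarrow> 0 < phi a t"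
    using phi_initially_positive[of s a] s by auto
  have "0 < v T1 * phi a \<delta>" "0 < phi a \<delta>"
    using \<delta>(1,2) \<delta>(3)[of \<delta>] u[of \<delta>] uv(4)[rule_format, of \<delta>] by simp_all
  then have v: "0 < v T1"
    by (simp add: zero_less_mult_iff)
  have "0 < phi a t" if "t \<in> {T1<..<s}" for t
  proof -
    have "0 < v T1 * phi a t"
      using uv(4)[rule_format, OF that] u[of t] that by simp
    then show ?thesis
      using v by (simp add: zero_less_mult_iff)
  qed
  moreover have "phi a s = 0"
    using u[of s] uv(3) v s by auto
  ultimately show "principal a s"
    using s a by (auto simp: principal_def)
next
  assume "principal a s"
  then show "positive_solution T1 s p (\<lambda>t. q t - a * m t)"
    unfolding positive_solution_def using s sl_pair_subset[OF phi_psi, of T1 s a]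
    by (intro exI[of _ "phi a"] exI[of _ "psi a"]) (auto simp: principal_def phi_T1)
qed

definition eigval :: "real \<Rightarrow> real" where "eigval s = (THE a. principal a s)"

text \<open>
  When \<open>m\<close> is positive somewhere in the interior, the principal eigenvalue on \<open>[T1, s]\<close> exists exactly for
  \<open>s > onset\<close>.
\<close>
definition onset :: real where "onset = Inf {t \<in> {T1<..<T2}. 0 < m t}"

lemma eigval_eq: "principal a s \<Longrightarrow> eigval s = a"
  unfolding eigval_def using principal_unique by blast

lemma onset_less_iff:
  assumes "\<exists>t\<in>{T1<..<T2}. 0 < m t" "s \<in> {T1<..T2}"
  shows "onset < s \<longleftrightarrow> (\<exists>t\<in>{T1<..<s}. 0 < m t)"
proof -
  have "bdd_below {t \<in> {T1<..<T2}. 0 < m t}"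
    by (rule bdd_belowI[of _ T1]) auto
  then have "onset < s \<longleftrightarrow> (\<exists>t\<in>{t \<in> {T1<..<T2}. 0 < m t}. t < s)"
    unfolding onset_def using assms(1) by (intro cInf_less_iff) auto
  then show ?thesis
    using assms(2) by auto
qed

lemma onset_bounds:
  assumes "\<exists>t\<in>{T1<..<T2}. 0 < m t"
  shows "T1 \<le> onset" "onset < T2"
proof -
  show "T1 \<le> onset"
    unfolding onset_def using assms by (intro cInf_greatest) auto
  show "onset < T2"
    using onset_less_iff[OF assms, of T2] assms T by auto
qed

context
  assumes m_pos: "\<exists>t\<in>{T1<..<T2}. 0 < m t"
begin

lemma principal_eigval:
  assumes "s \<in> {onset<..T2}"
  shows "principal (eigval s) s"
proof -
  have s: "s \<in> {T1<..T2}"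
    using assms onset_bounds[OF m_pos] by auto
  then have "\<exists>t\<in>{T1<..<s}. 0 < m t"
    using onset_less_iff[OF m_pos s] assms by simp
  then obtain a where "principal a s"
    using principal_exists[OF s] by blast
  then show ?thesis
    using eigval_eq by simp
qed

lemma eigval_pos: "s \<in> {onset<..T2} \<Longrightarrow> 0 < eigval s"
  using principal_eigval[of s] by (simp add: principal_def)

lemma positive_solution_iff_eigval:
  assumes "s \<in> {T1<..T2}" "0 < a"
  shows "positive_solution T1 s p (\<lambda>t. q t - a * m t) \<longleftrightarrow> onset < s \<and> a = eigval s"
  unfolding positive_solution_iff_principal[OF assms]
proof
  assume "principal a s"
  then show "onset < s \<and> a = eigval s"
    using principal_imp_weight_positive[of a s] onset_less_iff[OF m_pos assms(1)] eigval_eq[of a s]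
    by simp
next
  assume "onset < s \<and> a = eigval s"
  then show "principal a s"
    using principal_eigval[of s] assms by simp
qed

lemma eigval_less:
  assumes "onset < s1" "s1 < s2" "s2 \<le> T2"
  shows "eigval s2 < eigval s1"
  by (rule principal_parameter_less[OF principal_eigval principal_eigval \<open>s1 < s2\<close>]) (use assms in auto)

lemma eigval_image:
  assumes "s0 \<in> {onset<..T2}"
  shows "eigval ` {onset<..<s0} = {eigval s0<..}"
proof (intro equalityI subsetI)
  fix a assume "a \<in> eigval ` {onset<..<s0}"
  then show "a \<in> {eigval s0<..}"
    using assms eigval_less by auto
next
  fix a assume "a \<in> {eigval s0<..}"
  then obtain s where s: "s \<in> {T1<..<s0}" "principal a s"
    using principal_of_larger_parameter[OF principal_eigval[OF assms]] by auto
  then have "onset < s"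
    using onset_less_iff[OF m_pos, of s] principal_imp_weight_positive[OF s(2)] assms by auto
  then show "a \<in> eigval ` {onset<..<s0}"
    using s eigval_eq[OF s(2)] by auto
qed

text \<open>
  A monotone function whose range is an interval is continuous.
\<close>
lemma continuous_on_eigval: "continuous_on {onset<..<T2} eigval"
proof -
  have "(\<lambda>s. - eigval s) ` {onset<..<T2} = uminus ` eigval ` {onset<..<T2}"
    by (simp add: image_image)
  also have "\<dots> = {..< - eigval T2}"
    using eigval_image[of T2] onset_bounds(2)[OF m_pos] by simp
  finally have img: "(\<lambda>s. - eigval s) ` {onset<..<T2} = {..< - eigval T2}" .
  have "continuous_on {onset<..<T2} (\<lambda>s. - eigval s)"
  proof (rule continuous_onI_mono)
    show "open ((\<lambda>s. - eigval s) ` {onset<..<T2})"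
      unfolding img by simp
    show "- eigval x \<le> - eigval y" if "x \<in> {onset<..<T2}" "y \<in> {onset<..<T2}" "x \<le> y" for x y
      using eigval_less[of x y] that by (cases "x = y") auto
  qed
  from continuous_on_minus[OF this] show ?thesis
    by simp
qed

end

text \<open>
  At \<open>a = b\<close> this is the weighted square norm \<open>\<integral> m (phi a)\<^sup>2\<close>; off the diagonal it measures the change of the
  solution with the parameter through \<open>wronskian_eq_cross\<close>.
\<close>
definition cross :: "real \<Rightarrow> real \<Rightarrow> real \<Rightarrow> real" where
  "cross a b t = integral {T1..t} (\<lambda>r. m r * phi a r * phi b r)"

lemma cross_within:
  assumes "t \<in> {T1..T2}"
  shows "(cross a b has_real_derivative m t * phi a t * phi b t) (at t within {T1..T2})"
  unfolding cross_def
  by (rule integral_has_real_derivative[OF continuous_on_mult[OF continuous_on_mult[OF cont_m cont_phi] cont_phi] assms])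

lemma cross_T1: "cross a b T1 = 0"
  by (simp add: cross_def)

lemma continuous_on_cross: "continuous_on {T1..T2} (cross a b)"
  by (rule DERIV_continuous_on[OF cross_within])

lemma wronskian_eq_cross:
  assumes t: "t \<in> {T1..T2}"
  shows "phi b t * psi a t - phi a t * psi b t = (b - a) * cross a b t"
proof -
  define D where "D t = phi b t * psi a t - phi a t * psi b t - (b - a) * cross a b t" for t
  have "\<exists>c. \<forall>x\<in>{T1..T2}. D x = c"
  proof (rule has_field_derivative_zero_constant)
    show "(D has_real_derivative 0) (at x within {T1..T2})" if x: "x \<in> {T1..T2}" for x
      unfolding D_def
      by (rule derivative_eq_intros phi_within[OF x] psi_within[OF x] cross_within[OF x] refl)+
        (simp add: algebra_simps)
  qed simp
  then obtain c where "\<And>x. x \<in> {T1..T2} \<Longrightarrow> D x = c" by blast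
  then have "D t = D T1"
    using t T by simp
  then show ?thesis
    by (simp add: D_def phi_T1 cross_T1)
qed

lemma cross_tendsto:
  assumes A: "(A \<longlongrightarrow> a0) F" and B: "(B \<longlongrightarrow> b0) F"
    and \<tau>: "(\<tau> \<longlongrightarrow> t0) F" "eventually (\<lambda>x. \<tau> x \<in> {T1..T2}) F" and t0: "t0 \<in> {T1..T2}"
  shows "((\<lambda>x. cross (A x) (B x) (\<tau> x)) \<longlongrightarrow> cross a0 b0 t0) F"
proof -
  obtain L1 where L1: "\<And>a t. \<bar>a - a0\<bar> \<le> 1 \<Longrightarrow> t \<in> {T1..T2} \<Longrightarrow> \<bar>phi a t - phi a0 t\<bar> \<le> L1 * \<bar>a - a0\<bar>"
    using phi_psi_lipschitz by metis
  obtain L2 where L2: "\<And>a t. \<bar>a - b0\<bar> \<le> 1 \<Longrightarrow> t \<in> {T1..T2} \<Longrightarrow> \<bar>phi a t - phi b0 t\<bar> \<le> L2 * \<bar>a - b0\<bar>"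
    using phi_psi_lipschitz by metis
  obtain Nm where Nm: "0 < Nm" "\<And>t. t \<in> {T1..T2} \<Longrightarrow> \<bar>m t\<bar> \<le> Nm"
    using continuous_on_Icc_abs_bound[OF cont_m] by metis
  obtain Na where Na: "0 < Na" "\<And>t. t \<in> {T1..T2} \<Longrightarrow> \<bar>phi a0 t\<bar> \<le> Na"
    using continuous_on_Icc_abs_bound[OF cont_phi] by metis
  obtain Nb where Nb: "0 < Nb" "\<And>t. t \<in> {T1..T2} \<Longrightarrow> \<bar>phi b0 t\<bar> \<le> Nb"
    using continuous_on_Icc_abs_bound[OF cont_phi] by metis
  define \<epsilon> where "\<epsilon> x = Nm * (L1 * \<bar>A x - a0\<bar> * (Nb + L2 * \<bar>B x - b0\<bar>) + Na * (L2 * \<bar>B x - b0\<bar>))" for x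
  have "((\<lambda>x. \<epsilon> x * (T2 - T1)) \<longlongrightarrow>
      Nm * (L1 * \<bar>a0 - a0\<bar> * (Nb + L2 * \<bar>b0 - b0\<bar>) + Na * (L2 * \<bar>b0 - b0\<bar>)) * (T2 - T1)) F"
    unfolding \<epsilon>_def by (intro tendsto_intros A B)
  then have lim0: "((\<lambda>x. \<epsilon> x * (T2 - T1)) \<longlongrightarrow> 0) F"
    by simp
  have near: "eventually (\<lambda>x. \<bar>A x - a0\<bar> \<le> 1) F" "eventually (\<lambda>x. \<bar>B x - b0\<bar> \<le> 1) F"
    by (rule eventually_mono[OF tendstoD[OF A, of 1]], simp, simp add: dist_real_def)
      (rule eventually_mono[OF tendstoD[OF B, of 1]], simp, simp add: dist_real_def)
  have "((\<lambda>x. cross (A x) (B x) (\<tau> x) - cross a0 b0 (\<tau> x)) \<longlongrightarrow> 0) F"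
  proof (rule Lim_null_comparison[OF _ lim0])
    show "eventually (\<lambda>x. norm (cross (A x) (B x) (\<tau> x) - cross a0 b0 (\<tau> x)) \<le> \<epsilon> x * (T2 - T1)) F"
      using near \<tau>(2)
    proof eventually_elim
      case (elim x)
      have bound: "\<bar>m r * phi (A x) r * phi (B x) r - m r * phi a0 r * phi b0 r\<bar> \<le> \<epsilon> x"
        if r: "r \<in> {T1..T2}" for r
      proof -
        have 1: "\<bar>phi (A x) r - phi a0 r\<bar> \<le> L1 * \<bar>A x - a0\<bar>"
          and 2: "\<bar>phi (B x) r - phi b0 r\<bar> \<le> L2 * \<bar>B x - b0\<bar>"
          using L1[OF elim(1) r] L2[OF elim(2) r] by auto
        have 3: "\<bar>phi (B x) r\<bar> \<le> Nb + L2 * \<bar>B x - b0\<bar>"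
          using 2 Nb(2)[OF r] by linarith
        have expand: "m r * phi (A x) r * phi (B x) r - m r * phi a0 r * phi b0 r =
            m r * ((phi (A x) r - phi a0 r) * phi (B x) r + phi a0 r * (phi (B x) r - phi b0 r))"
          by (simp add: algebra_simps)
        have "\<bar>(phi (A x) r - phi a0 r) * phi (B x) r + phi a0 r * (phi (B x) r - phi b0 r)\<bar>
            \<le> L1 * \<bar>A x - a0\<bar> * (Nb + L2 * \<bar>B x - b0\<bar>) + Na * (L2 * \<bar>B x - b0\<bar>)"
        proof -
          have "\<bar>(phi (A x) r - phi a0 r) * phi (B x) r\<bar> \<le> L1 * \<bar>A x - a0\<bar> * (Nb + L2 * \<bar>B x - b0\<bar>)"
            unfolding abs_mult by (rule mult_mono) (use 1 3 in auto)
          moreover have "\<bar>phi a0 r * (phi (B x) r - phi b0 r)\<bar> \<le> Na * (L2 * \<bar>B x - b0\<bar>)"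
            unfolding abs_mult by (rule mult_mono) (use 2 Na(1) Na(2)[OF r] in auto)
          ultimately show ?thesis
            by (rule order_trans[OF abs_triangle_ineq add_mono])
        qed
        from mult_mono[OF Nm(2)[OF r] this] have "\<bar>m r * ((phi (A x) r - phi a0 r) * phi (B x) r + phi a0 r * (phi (B x) r - phi b0 r))\<bar> \<le> \<epsilon> x"
          unfolding abs_mult[of "m r"] \<epsilon>_def using Nm(1) by simp
        with expand show ?thesis by simp
      qed
      have "0 \<le> \<epsilon> x"
        using bound[OF t0] by linarith
      have "\<bar>cross (A x) (B x) (\<tau> x) - cross a0 b0 (\<tau> x)\<bar> \<le> \<epsilon> x * (\<tau> x - T1)"
      proof (rule abs_le_of_abs_deriv_le[where f = "\<lambda>t. cross (A x) (B x) t - cross a0 b0 t"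
            and G = "\<lambda>t. \<epsilon> x * (t - T1)" and G' = "\<lambda>_. \<epsilon> x"
            and f' = "\<lambda>r. m r * phi (A x) r * phi (B x) r - m r * phi a0 r * phi b0 r"])
        show "((\<lambda>t. cross (A x) (B x) t - cross a0 b0 t) has_real_derivative
            m r * phi (A x) r * phi (B x) r - m r * phi a0 r * phi b0 r) (at r within {T1..T2})"
          if "r \<in> {T1..T2}" for r
          by (intro DERIV_diff cross_within that)
        show "((\<lambda>t. \<epsilon> x * (t - T1)) has_real_derivative \<epsilon> x) (at r within {T1..T2})" for r
          by (rule derivative_eq_intros refl)+ simp
      qed (use bound elim in \<open>auto simp: cross_T1\<close>)
      also have "\<dots> \<le> \<epsilon> x * (T2 - T1)"
        using elim \<open>0 \<le> \<epsilon> x\<close> by (intro mult_left_mono) auto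
      finally show ?case by simp
    qed
  qed
  moreover have "((\<lambda>x. cross a0 b0 (\<tau> x)) \<longlongrightarrow> cross a0 b0 t0) F"
    by (rule continuous_on_tendsto_compose[OF continuous_on_cross \<tau>(1) t0 \<tau>(2)])
  ultimately have "((\<lambda>x. (cross (A x) (B x) (\<tau> x) - cross a0 b0 (\<tau> x)) + cross a0 b0 (\<tau> x))
      \<longlongrightarrow> 0 + cross a0 b0 t0) F"
    by (rule tendsto_add)
  then show ?thesis by simp
qed

text \<open>
  Although \<open>m\<close> may change sign, the weighted square norm of a principal eigenfunction is positive: by the energy identity
  \<open>a \<integral> m (phi a)\<^sup>2 = \<integral> ((psi a)\<^sup>2 / p + q (phi a)\<^sup>2)\<close> on \<open>[T1, s]\<close>, and the right-hand side is positive.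
\<close>
lemma cross_pos:
  assumes "principal a s"
  shows "0 < cross a a s"
proof (rule ccontr)
  assume contra: "\<not> 0 < cross a a s"
  have a: "0 < a" and s: "T1 < s" "s \<le> T2" and zero: "phi a s = 0"
    using assms by (auto simp: principal_def)
  \<comment> \<open>The boundary term \<open>phi a * psi a\<close> vanishes at both ends, so \<open>F s\<close> is \<open>a\<close> times the norm.\<close>
  define F where "F t = a * cross a a t + phi a t * psi a t" for t
  define F' where "F' t = q t * (phi a t)\<^sup>2 + (psi a t)\<^sup>2 / p t" for t
  have DF: "(F has_real_derivative F' t) (at t within {T1..T2})" if t: "t \<in> {T1..T2}" for t
    unfolding F_def
    by (rule derivative_eq_intros phi_within[OF t] psi_within[OF t] cross_within[OF t] refl)+
      (simp add: F'_def algebra_simps power2_eq_square)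
  have DF_at: "(F has_real_derivative F' t) (at t)" if "t \<in> {T1<..<s}" for t
    using DF[of t] at_within_Icc_at[of T1 t T2] that s by auto
  have nonneg: "0 \<le> F' t" if "t \<in> {T1..T2}" for t
    using q_nonneg[OF that] p_pos[OF that] by (auto simp: F'_def)
  have F0: "F T1 = 0"
    by (simp add: F_def phi_T1 cross_T1)
  have "F T1 \<le> F s"
    by (rule deriv_nonneg_imp_le[OF DF]) (use nonneg s in auto)
  moreover have "F s \<le> 0"
    using contra a by (simp add: F_def zero mult_nonneg_nonpos)
  ultimately have Fs: "F s = 0"
    using F0 by simp
  have cont: "continuous_on {T1..s} F"
  proof (rule continuous_on_subset)
    show "continuous_on {T1..T2} F"
      by (rule DERIV_continuous_on[OF DF])
  qed (use s in auto)
  have "(F \<longlongrightarrow> F T1) (at T1 within {T1..s})" "(F \<longlongrightarrow> F s) (at s within {T1..s})"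
    using cont s unfolding continuous_on_def by auto
  then have lim1: "(F \<longlongrightarrow> 0) (at_right T1)" and lim2: "(F \<longlongrightarrow> 0) (at_left s)"
    unfolding F0 Fs at_within_Icc_at_right[OF s(1)] at_within_Icc_at_left[OF s(1)] by simp_all
  obtain \<delta> where \<delta>: "T1 < \<delta>" "\<delta> < s" "\<And>t. t \<in> {T1..\<delta>} \<Longrightarrow> 1 / 2 < psi a t"
    using psi_initially_large[OF s] by metis
  have "F' \<delta> = 0"
    by (rule nondecreasing_equal_limits_imp_deriv_0[OF DF_at _ lim1 lim2]) (use nonneg \<delta> s in auto)
  moreover have "0 < (psi a \<delta>)\<^sup>2 / p \<delta>" "0 \<le> q \<delta> * (phi a \<delta>)\<^sup>2"
    using \<delta>(3)[of \<delta>] \<delta>(1,2) s p_pos[of \<delta>] q_nonneg[of \<delta>] by auto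
  ultimately show False
    by (simp add: F'_def)
qed

lemma phi_mean_value:
  assumes "r \<in> {T1..T2}" "s \<in> {T1..T2}"
  shows "\<exists>\<xi>\<in>{T1..T2}. \<bar>\<xi> - s\<bar> \<le> \<bar>r - s\<bar> \<and> phi b r - phi b s = (r - s) * (psi b \<xi> / p \<xi>)"
proof -
  have *: "\<exists>\<xi>\<in>{x<..<y}. phi b y - phi b x = (psi b \<xi> / p \<xi>) * (y - x)"
    if "x < y" "x \<in> {T1..T2}" "y \<in> {T1..T2}" for x y
  proof -
    have "(phi b has_derivative (*) (psi b t / p t)) (at t within {x..y})" if "t \<in> {x..y}" for t
      using DERIV_subset[OF phi_within[of t b], of "{x..y}"] that \<open>x \<in> _\<close> \<open>y \<in> _\<close>
      by (auto simp: has_field_derivative_def)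
    then show ?thesis
      by (rule mvt_simple[OF \<open>x < y\<close>, where f' = "\<lambda>t. (*) (psi b t / p t)"]) simp
  qed
  consider "r = s" | "r < s" | "s < r" by linarith
  then show ?thesis
  proof cases
    case 1
    then show ?thesis using assms by (intro bexI[of _ s]) auto
  next
    case 2
    then obtain \<xi> where "\<xi> \<in> {r<..<s}" "phi b s - phi b r = (psi b \<xi> / p \<xi>) * (s - r)"
      using *[of r s] assms by blast
    moreover from this(2) have "phi b r - phi b s = (r - s) * (psi b \<xi> / p \<xi>)"
      by (metis minus_diff_eq mult.commute mult_minus_left)
    ultimately show ?thesis
      using assms by (intro bexI[of _ \<xi>]) auto
  next
    case 3
    then obtain \<xi> where "\<xi> \<in> {s<..<r}" "phi b r - phi b s = (psi b \<xi> / p \<xi>) * (r - s)"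
      using *[of s r] assms by blast
    then show ?thesis
      using assms by (intro bexI[of _ \<xi>]) (auto simp: algebra_simps)
  qed
qed

text \<open>
  Hadamard's formula \<open>- p(s) u'(s)\<^sup>2 / \<integral> m u\<^sup>2\<close> for the derivative of an eigenvalue with respect to the
  endpoint, written with \<open>psi = p u'\<close>.
\<close>
definition eigval_deriv :: "real \<Rightarrow> real" where
  "eigval_deriv s = - (psi (eigval s) s)\<^sup>2 / (p s * cross (eigval s) (eigval s) s)"

context
  assumes m_pos: "\<exists>t\<in>{T1<..<T2}. 0 < m t"
begin

lemma eigval_deriv_neg:
  assumes s: "s \<in> {onset<..<T2}"
  shows "eigval_deriv s < 0"
proof -
  have pr: "principal (eigval s) s"
    using s by (intro principal_eigval[OF m_pos]) auto
  then have "psi (eigval s) s \<noteq> 0"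
    by (intro phi_psi_nontrivial) (auto simp: principal_def)
  moreover have "0 < p s"
    using pr by (intro p_pos) (auto simp: principal_def)
  ultimately show ?thesis
    using cross_pos[OF pr] by (simp add: eigval_deriv_def)
qed

text \<open>
  Put \<open>a = eigval s\<close> and \<open>b = eigval r\<close>. At \<open>s\<close> the Wronskian identity reads
  \<open>phi b s * psi a s = (b - a) * cross a b s\<close>, and since \<open>phi b r = 0\<close> the mean value theorem turns
  \<open>phi b s\<close> into \<open>-(r - s)\<close> times a slope of \<open>phi b\<close> at a point between \<open>r\<close> and \<open>s\<close>. Dividing gives the difference
  quotient as a jointly continuous expression in \<open>b\<close> and that point, and \<open>b\<close> tends to \<open>a\<close> as \<open>r\<close> tends to \<open>s\<close>.
\<close>
lemma eigval_DERIV: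
  assumes s: "s \<in> {onset<..<T2}"
  shows "(eigval has_real_derivative eigval_deriv s) (at s)"
proof -
  define a where "a = eigval s"
  have sT: "s \<in> {T1..T2}"
    using s onset_bounds[OF m_pos] by auto
  have pr: "principal a s"
    unfolding a_def using s by (intro principal_eigval[OF m_pos]) auto
  have lim_a: "(eigval \<longlongrightarrow> a) (at s)"
    using continuous_on_eigval[OF m_pos] s unfolding a_def
    by (metis continuous_on_eq_continuous_at isCont_def open_greaterThanLessThan)
  have near: "eventually (\<lambda>r. r \<in> {onset<..<T2}) (at s)"
    using s by (intro eventually_at_in_open') auto
  have "\<forall>r. \<exists>\<xi>. r \<in> {T1..T2} \<longrightarrow> \<xi> \<in> {T1..T2} \<and> \<bar>\<xi> - s\<bar> \<le> \<bar>r - s\<bar> \<and>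
      phi (eigval r) r - phi (eigval r) s = (r - s) * (psi (eigval r) \<xi> / p \<xi>)"
    using phi_mean_value[OF _ sT] by blast
  then obtain \<xi> where \<xi>: "\<And>r. r \<in> {T1..T2} \<Longrightarrow> \<xi> r \<in> {T1..T2}"
      "\<And>r. r \<in> {T1..T2} \<Longrightarrow> \<bar>\<xi> r - s\<bar> \<le> \<bar>r - s\<bar>"
      "\<And>r. r \<in> {T1..T2} \<Longrightarrow> phi (eigval r) r - phi (eigval r) s = (r - s) * (psi (eigval r) (\<xi> r) / p (\<xi> r))"
    by metis
  have nearT: "eventually (\<lambda>r. r \<in> {T1..T2}) (at s)"
    using near by eventually_elim (use onset_bounds[OF m_pos] in auto)
  have \<xi>T: "eventually (\<lambda>r. \<xi> r \<in> {T1..T2}) (at s)"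
    using nearT by eventually_elim (rule \<xi>)
  have "((\<lambda>r. \<bar>r - s\<bar>) \<longlongrightarrow> \<bar>s - s\<bar>) (at s)"
    by (intro tendsto_intros)
  then have "((\<lambda>r. \<xi> r - s) \<longlongrightarrow> 0) (at s)"
    by (intro Lim_null_comparison[of "\<lambda>r. \<xi> r - s" "\<lambda>r. \<bar>r - s\<bar>"])
      (use nearT \<xi>(2) in \<open>auto elim!: eventually_mono\<close>)
  then have lim_\<xi>: "(\<xi> \<longlongrightarrow> s) (at s)"
    by (simp add: LIM_zero_iff)
  have lim_cross: "((\<lambda>r. cross a (eigval r) s) \<longlongrightarrow> cross a a s) (at s)"
    using sT by (intro cross_tendsto lim_a tendsto_const) auto
  have "((\<lambda>r. - (psi (eigval r) (\<xi> r) / p (\<xi> r) * psi a s) / cross a (eigval r) s) \<longlongrightarrow>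
      - (psi a s / p s * psi a s) / cross a a s) (at s)"
    using p_pos[OF sT] cross_pos[OF pr] sT
    by (intro tendsto_intros phi_tendsto lim_a lim_\<xi> \<xi>T lim_cross
        continuous_on_tendsto_compose[OF cont_p lim_\<xi>]) auto
  also have "- (psi a s / p s * psi a s) / cross a a s = eigval_deriv s"
    by (simp add: eigval_deriv_def a_def power2_eq_square)
  finally have "((\<lambda>r. (eigval r - eigval s) / (r - s)) \<longlongrightarrow> eigval_deriv s) (at s)"
  proof (rule Lim_transform_eventually)
    have "eventually (\<lambda>r. 0 < cross a (eigval r) s) (at s)"
      using lim_cross cross_pos[OF pr] by (rule order_tendstoD)
    moreover have "eventually (\<lambda>r. r \<noteq> s) (at s)"
      by (simp add: eventually_at_filter)
    ultimately show "eventually (\<lambda>r. - (psi (eigval r) (\<xi> r) / p (\<xi> r) * psi a s) / cross a (eigval r) s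
        = (eigval r - eigval s) / (r - s)) (at s)"
      using near nearT
    proof eventually_elim
      case (elim r)
      have "principal (eigval r) r"
        using elim by (intro principal_eigval[OF m_pos]) auto
      then have "- phi (eigval r) s = (r - s) * (psi (eigval r) (\<xi> r) / p (\<xi> r))"
        using \<xi>(3)[OF elim(4)] by (simp add: principal_def)
      moreover have "phi (eigval r) s * psi a s = (eigval r - a) * cross a (eigval r) s"
        using wronskian_eq_cross[OF sT, of "eigval r" a] pr by (simp add: principal_def)
      ultimately have "- ((r - s) * (psi (eigval r) (\<xi> r) / p (\<xi> r))) * psi a s
          = (eigval r - a) * cross a (eigval r) s"
        by (metis minus_minus)
      then show ?case
        using elim(1,2) unfolding a_def[symmetric]
        by (subst frac_eq_eq) (auto simp: mult_ac)
    qed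
  qed
  then show ?thesis
    by (simp add: has_field_derivative_iff)
qed

lemma continuous_on_eigval_deriv: "continuous_on {onset<..<T2} eigval_deriv"
  unfolding continuous_on_def
proof
  fix s assume s: "s \<in> {onset<..<T2}"
  let ?F = "at s within {onset<..<T2}"
  have sT: "s \<in> {T1..T2}"
    using s onset_bounds[OF m_pos] by auto
  have lim: "(eigval \<longlongrightarrow> eigval s) ?F"
    using continuous_on_eigval[OF m_pos] s by (simp add: continuous_on_def)
  have T: "eventually (\<lambda>r. r \<in> {T1..T2}) ?F"
    using onset_bounds[OF m_pos] by (auto simp: eventually_at_filter)
  have "0 < cross (eigval s) (eigval s) s"
    using s by (intro cross_pos principal_eigval[OF m_pos]) auto
  then show "(eigval_deriv \<longlongrightarrow> eigval_deriv s) ?F"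
    unfolding eigval_deriv_def using p_pos[OF sT]
    by (intro tendsto_intros phi_tendsto cross_tendsto lim T sT
        continuous_on_tendsto_compose[OF cont_p _ sT]) auto
qed

end

end

section \<open>Curves with one decreasing and one increasing coordinate\<close>

text \<open>
  The graph function is \<open>f = y \<circ> x\<^sup>-\<^sup>1\<close>. The inverse of \<open>x\<close> is continuous because it is monotone with an interval as its
  range, so the inverse function rule gives \<open>f' = y' / x' < 0\<close>.
\<close>
lemma hyperbolic_like_pos_parametrized:
  fixes x y x' y' :: "real \<Rightarrow> real"
  assumes "c < d"
    and img: "x ` {c<..<d} = {\<nu><..}" "y ` {c<..<d} = {\<mu><..}" and nonneg: "0 \<le> \<nu>" "0 \<le> \<mu>"
    and Dx: "\<And>s. s \<in> {c<..<d} \<Longrightarrow> (x has_real_derivative x' s) (at s)"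
    and Dy: "\<And>s. s \<in> {c<..<d} \<Longrightarrow> (y has_real_derivative y' s) (at s)"
    and neg: "\<And>s. s \<in> {c<..<d} \<Longrightarrow> x' s < 0" and pos: "\<And>s. s \<in> {c<..<d} \<Longrightarrow> 0 < y' s"
    and cont: "continuous_on {c<..<d} x'" "continuous_on {c<..<d} y'"
  shows "hyperbolic_like_pos ((\<lambda>s. (x s, y s)) ` {c<..<d})"
proof -
  have x_less: "x t < x s" if "s \<in> {c<..<d}" "t \<in> {c<..<d}" "s < t" for s t
    using Dx neg that
    by (intro DERIV_neg_imp_decreasing[OF \<open>s < t\<close>]) (meson greaterThanLessThan_iff le_less_trans less_le_trans)
  have y_less: "y s < y t" if "s \<in> {c<..<d}" "t \<in> {c<..<d}" "s < t" for s t
    using Dy pos that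
    by (intro DERIV_pos_imp_increasing[OF \<open>s < t\<close>]) (meson greaterThanLessThan_iff le_less_trans less_le_trans)
  have inj: "inj_on x {c<..<d}"
    by (rule linorder_inj_onI) (use x_less in force)+
  define S where "S = the_inv_into {c<..<d} x"
  have S: "S a \<in> {c<..<d}" "x (S a) = a" if "a \<in> {\<nu><..}" for a
    using the_inv_into_into[OF inj, of a "{c<..<d}"] f_the_inv_into_f[OF inj, of a] that
    unfolding S_def img by auto
  have Sx: "S (x s) = s" if "s \<in> {c<..<d}" for s
    unfolding S_def using the_inv_into_f_f[OF inj that] .
  have S_less: "S b < S a" if "a \<in> {\<nu><..}" "b \<in> {\<nu><..}" "a < b" for a b
  proof (rule ccontr)
    assume "\<not> S b < S a"
    then have "S a = S b \<or> S a < S b" by linarith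
    then show False
      using x_less[of "S a" "S b"] S[OF that(1)] S[OF that(2)] that(3) by auto
  qed
  have img_S: "S ` {\<nu><..} = {c<..<d}"
  proof (intro equalityI subsetI)
    fix s assume s: "s \<in> {c<..<d}"
    then have "x s \<in> {\<nu><..}" using img by blast
    then show "s \<in> S ` {\<nu><..}" using Sx[OF s] by (metis imageI)
  qed (use S in blast)
  have "continuous_on {\<nu><..} (\<lambda>a. - S a)"
  proof (rule continuous_onI_mono)
    have "(\<lambda>a. - S a) ` {\<nu><..} = uminus ` S ` {\<nu><..}"
      by (simp add: image_image)
    then show "open ((\<lambda>a. - S a) ` {\<nu><..})"
      unfolding img_S by simp
    show "- S a \<le> - S b" if "a \<in> {\<nu><..}" "b \<in> {\<nu><..}" "a \<le> b" for a b
      using S_less[of a b] that by (cases "a = b") auto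
  qed
  from continuous_on_minus[OF this] have cont_S: "continuous_on {\<nu><..} S"
    by simp
  have DS: "(S has_real_derivative inverse (x' (S a))) (at a)" if a: "a \<in> {\<nu><..}" for a
  proof (rule DERIV_inverse_function[where f = x and a = \<nu> and b = "a + 1"])
    show "(x has_real_derivative x' (S a)) (at (S a))"
      using Dx S a by blast
    show "x' (S a) \<noteq> 0"
      using neg[of "S a"] S a by force
    show "isCont S a"
      using cont_S a by (simp add: continuous_on_eq_continuous_at)
  qed (use a S in auto)
  define f where "f a = y (S a)" for a
  have Df: "(f has_real_derivative y' (S a) * inverse (x' (S a))) (at a)" if a: "a \<in> {\<nu><..}" for a
    unfolding f_def using S[OF a] by (intro DERIV_chain2[OF Dy DS] a) auto
  have quadrant: "(\<lambda>s. (x s, y s)) ` {c<..<d} \<subseteq> {0<..} \<times> {0<..}"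
  proof (clarify)
    fix s assume s: "s \<in> {c<..<d}"
    have "x s \<in> {\<nu><..}" "y s \<in> {\<mu><..}"
      using img s by blast+
    then show "x s \<in> {0<..} \<and> y s \<in> {0<..}"
      using nonneg by auto
  qed
  have antimono: "strict_antimono_on {\<nu><..} f"
  proof (rule monotone_onI)
    show "f b < f a" if "a \<in> {\<nu><..}" "b \<in> {\<nu><..}" "a < b" for a b
      unfolding f_def using S that by (intro y_less S_less) auto
  qed
  have onto: "f ` {\<nu><..} = {\<mu><..}"
  proof -
    have "f ` {\<nu><..} = y ` S ` {\<nu><..}"
      by (simp add: f_def image_image)
    then show ?thesis
      unfolding img_S img .
  qed
  have C1: "f C1_differentiable_on {\<nu><..}"
    unfolding C1_differentiable_on_def
  proof (intro exI conjI ballI)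
    show "(f has_vector_derivative y' (S a) * inverse (x' (S a))) (at a)" if "a \<in> {\<nu><..}" for a
      using Df[OF that] by (simp add: has_real_derivative_iff_has_vector_derivative)
    have "x' (S a) \<noteq> 0" if "a \<in> {\<nu><..}" for a
      using neg[of "S a"] S that by force
    then show "continuous_on {\<nu><..} (\<lambda>a. y' (S a) * inverse (x' (S a)))"
      using cont img_S
      by (intro continuous_intros continuous_on_compose2[OF _ cont_S]) auto
  qed
  have deriv: "deriv f a < 0" if "a \<in> {\<nu><..}" for a
    using DERIV_imp_deriv[OF Df[OF that]] pos[of "S a"] neg[of "S a"] S that
    by (simp add: mult_pos_neg)
  have graph: "(\<lambda>s. (x s, y s)) ` {c<..<d} = {(a, f a) |a. a \<in> {\<nu><..}}"
  proof (intro equalityI subsetI)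
    fix z assume "z \<in> (\<lambda>s. (x s, y s)) ` {c<..<d}"
    then obtain s where s: "s \<in> {c<..<d}" "z = (x s, y s)" by blast
    moreover have "x s \<in> {\<nu><..}" using img s by blast
    ultimately show "z \<in> {(a, f a) |a. a \<in> {\<nu><..}}"
      using Sx[OF s(1)] by (auto simp: f_def)
  next
    fix z assume "z \<in> {(a, f a) |a. a \<in> {\<nu><..}}"
    then obtain a where a: "a \<in> {\<nu><..}" "z = (a, f a)" by blast
    then show "z \<in> (\<lambda>s. (x s, y s)) ` {c<..<d}"
      using S[OF a(1)] by (intro image_eqI[of _ _ "S a"]) (auto simp: f_def)
  qed
  have "\<exists>\<nu> \<mu> f. 0 \<le> \<nu> \<and> 0 \<le> \<mu> \<and> strict_antimono_on {\<nu><..} f \<and> f ` {\<nu><..} = {\<mu><..} \<and>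
      f C1_differentiable_on {\<nu><..} \<and> (\<forall>a\<in>{\<nu><..}. deriv f a < 0) \<and>
      (\<lambda>s. (x s, y s)) ` {c<..<d} = {(a, f a) |a. a \<in> {\<nu><..}}"
    using nonneg antimono onto C1 deriv graph by blast
  with quadrant show ?thesis
    unfolding hyperbolic_like_pos_def by blast
qed

text \<open>
  The mirror image in the diagonal: reversing the parameter makes the first coordinate decreasing again.
\<close>
lemma hyperbolic_like_pos_swap_parametrized:
  fixes x y x' y' :: "real \<Rightarrow> real"
  assumes "c < d"
    and img: "x ` {c<..<d} = {\<nu><..}" "y ` {c<..<d} = {\<mu><..}" and nonneg: "0 \<le> \<nu>" "0 \<le> \<mu>"
    and Dx: "\<And>s. s \<in> {c<..<d} \<Longrightarrow> (x has_real_derivative x' s) (at s)"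
    and Dy: "\<And>s. s \<in> {c<..<d} \<Longrightarrow> (y has_real_derivative y' s) (at s)"
    and neg: "\<And>s. s \<in> {c<..<d} \<Longrightarrow> x' s < 0" and pos: "\<And>s. s \<in> {c<..<d} \<Longrightarrow> 0 < y' s"
    and cont: "continuous_on {c<..<d} x'" "continuous_on {c<..<d} y'"
  shows "hyperbolic_like_pos ((\<lambda>s. (y s, x s)) ` {c<..<d})"
proof -
  have refl: "f ` {c<..<d} = (\<lambda>s. f (-s)) ` {-d<..<-c}" for f :: "real \<Rightarrow> 'a"
  proof -
    have "f ` {c<..<d} = f ` uminus ` {-d<..<-c}" by simp
    then show ?thesis by (simp only: image_image)
  qed
  have D: "((\<lambda>s. f (-s)) has_real_derivative - e) (at s)"
    if "(f has_real_derivative e) (at (-s))" for f e and s :: real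
    using that by (simp add: DERIV_mirror)
  have C: "continuous_on {-d<..<-c} (\<lambda>s. - f (-s))" if "continuous_on {c<..<d} f" for f :: "real \<Rightarrow> real"
    by (intro continuous_intros continuous_on_compose2[OF that]) auto
  have "hyperbolic_like_pos ((\<lambda>s. (y (-s), x (-s))) ` {-d<..<-c})"
  proof (rule hyperbolic_like_pos_parametrized[where x' = "\<lambda>s. - y' (-s)" and y' = "\<lambda>s. - x' (-s)"])
    show "(\<lambda>s. y (-s)) ` {-d<..<-c} = {\<mu><..}" "(\<lambda>s. x (-s)) ` {-d<..<-c} = {\<nu><..}"
      using img by (simp_all only: refl[of y] refl[of x])
  qed (use assms in \<open>auto intro!: D C\<close>)
  then show ?thesis
    by (simp only: refl[of "\<lambda>s. (y s, x s)"])
qed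

section \<open>Solutions with at most one interior zero\<close>

text \<open>
  The Fucik equation as a first-order system on the closed interval. It carries the same information as
  \<open>fucik_solution\<close>, where the equation is required only in the interior, because both sides are continuous
  up to the endpoints.
\<close>
definition fucik_pair ::
  "real \<Rightarrow> real \<Rightarrow> (real \<Rightarrow> real) \<Rightarrow> (real \<Rightarrow> real) \<Rightarrow> (real \<Rightarrow> real) \<Rightarrow> (real \<Rightarrow> real)
     \<Rightarrow> real \<Rightarrow> real \<Rightarrow> (real \<Rightarrow> real) \<Rightarrow> (real \<Rightarrow> real) \<Rightarrow> bool" where
  "fucik_pair T1 T2 p q m n a b u v \<longleftrightarrow>
     (\<forall>t\<in>{T1..T2}. (u has_real_derivative v t / p t) (at t within {T1..T2}) \<and>
        (v has_real_derivative q t * u t - a * m t * max (u t) 0 + b * n t * max (- u t) 0)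
          (at t within {T1..T2}))"

locale fucik_problem =
  fixes T1 T2 :: real and p q m n :: "real \<Rightarrow> real"
  assumes T: "T1 < T2"
    and cont: "continuous_on {T1..T2} p" "continuous_on {T1..T2} q"
      "continuous_on {T1..T2} m" "continuous_on {T1..T2} n"
    and p_pos: "\<And>t. t \<in> {T1..T2} \<Longrightarrow> 0 < p t" and q_nonneg: "\<And>t. t \<in> {T1..T2} \<Longrightarrow> 0 \<le> q t"
begin

lemma deriv_on_eq:
  assumes "(f has_real_derivative d) (at t within {T1..T2})" "t \<in> {T1..T2}"
  shows "deriv_on T1 T2 f t = d"
  unfolding deriv_on_def
  using assms T by (intro vector_derivative_within_closed_interval)
    (auto simp: has_real_derivative_iff_has_vector_derivative)

lemma C1_closed_has_deriv_on:
  assumes "C1_closed T1 T2 f" "t \<in> {T1..T2}"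
  shows "(f has_real_derivative deriv_on T1 T2 f t) (at t within {T1..T2})"
  using assms unfolding C1_closed_def differentiable_on_def deriv_on_def
  by (auto simp: has_real_derivative_iff_has_vector_derivative simp flip: vector_derivative_works)

lemma C1_closedI:
  assumes "\<And>t. t \<in> {T1..T2} \<Longrightarrow> (f has_real_derivative f' t) (at t within {T1..T2})"
    and "continuous_on {T1..T2} f'"
  shows "C1_closed T1 T2 f"
  unfolding C1_closed_def differentiable_on_def
proof
  show "\<forall>t\<in>{T1..T2}. f differentiable (at t within {T1..T2})"
    using assms(1) by (meson differentiableI has_field_derivative_imp_has_derivative)
  show "continuous_on {T1..T2} (deriv_on T1 T2 f)"
    using deriv_on_eq[OF assms(1)] by (intro continuous_on_cong[THEN iffD1, OF refl _ assms(2)]) auto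
qed

lemma fucik_solution_imp_pair:
  assumes "fucik_solution T1 T2 p q m n a b u"
  shows "fucik_pair T1 T2 p q m n a b u (\<lambda>t. p t * deriv_on T1 T2 u t)"
proof -
  define v where "v t = p t * deriv_on T1 T2 u t" for t
  define F where "F t = q t * u t - a * m t * max (u t) 0 + b * n t * max (- u t) 0" for t
  have C1: "C1_closed T1 T2 u" "C1_closed T1 T2 v"
    and eq: "\<And>t. t \<in> {T1<..<T2} \<Longrightarrow> deriv_on T1 T2 v t - F t = 0"
    using assms unfolding fucik_solution_def v_def F_def by (auto simp: algebra_simps)
  have Du: "(u has_real_derivative deriv_on T1 T2 u t) (at t within {T1..T2})" if "t \<in> {T1..T2}" for t
    using C1_closed_has_deriv_on[OF C1(1) that] .
  have cont_u: "continuous_on {T1..T2} u"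
    by (rule DERIV_continuous_on[OF Du])
  have cont_F: "continuous_on {T1..T2} F"
    unfolding F_def by (intro continuous_intros cont cont_u)
  have cl: "closure {T1<..<T2} = {T1..T2}"
    using T by simp
  have F: "deriv_on T1 T2 v t = F t" if "t \<in> {T1..T2}" for t
  proof -
    have "deriv_on T1 T2 v t - F t = 0"
    proof (rule continuous_constant_on_closure[where S = "{T1<..<T2}" and f = "\<lambda>t. deriv_on T1 T2 v t - F t"])
      show "continuous_on (closure {T1<..<T2}) (\<lambda>t. deriv_on T1 T2 v t - F t)"
        unfolding cl using C1(2) by (intro continuous_intros cont_F) (simp add: C1_closed_def)
    qed (use eq that cl in auto)
    then show ?thesis by simp
  qed
  have "fucik_pair T1 T2 p q m n a b u v"
    unfolding fucik_pair_def F_def[symmetric]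
  proof (intro ballI conjI)
    fix t assume t: "t \<in> {T1..T2}"
    have "v t / p t = deriv_on T1 T2 u t"
      using p_pos[OF t] by (simp add: v_def)
    then show "(u has_real_derivative v t / p t) (at t within {T1..T2})"
      using Du[OF t] by simp
    show "(v has_real_derivative F t) (at t within {T1..T2})"
      using C1_closed_has_deriv_on[OF C1(2) t] F[OF t] by simp
  qed
  then show ?thesis
    by (simp add: v_def[abs_def])
qed

lemma fucik_pair_imp_solution:
  assumes uv: "fucik_pair T1 T2 p q m n a b u v" and "u T1 = 0" "u T2 = 0"
  shows "fucik_solution T1 T2 p q m n a b u"
    and "t \<in> {T1..T2} \<Longrightarrow> deriv_on T1 T2 u t = v t / p t"
proof -
  define F where "F t = q t * u t - a * m t * max (u t) 0 + b * n t * max (- u t) 0" for t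
  have Du: "(u has_real_derivative v t / p t) (at t within {T1..T2})"
    and Dv: "(v has_real_derivative F t) (at t within {T1..T2})" if "t \<in> {T1..T2}" for t
    using uv that unfolding fucik_pair_def F_def by auto
  have deriv_u: "deriv_on T1 T2 u t = v t / p t" if "t \<in> {T1..T2}" for t
    using deriv_on_eq[OF Du that] that by simp
  then show "t \<in> {T1..T2} \<Longrightarrow> deriv_on T1 T2 u t = v t / p t" .
  have pu: "p t * deriv_on T1 T2 u t = v t" if "t \<in> {T1..T2}" for t
    using deriv_u[OF that] p_pos[OF that] by simp
  have Dpu: "((\<lambda>t. p t * deriv_on T1 T2 u t) has_real_derivative F t) (at t within {T1..T2})"
    if "t \<in> {T1..T2}" for t
    by (rule has_field_derivative_transform_within[OF Dv[OF that], of 1]) (use that pu in auto)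
  have cont_uv: "continuous_on {T1..T2} u" "continuous_on {T1..T2} v"
    by (rule DERIV_continuous_on[OF Du], assumption, rule DERIV_continuous_on[OF Dv])
  have "C1_closed T1 T2 u"
    using p_pos by (intro C1_closedI[OF Du] continuous_intros cont cont_uv) force+
  moreover have "C1_closed T1 T2 (\<lambda>t. p t * deriv_on T1 T2 u t)"
    unfolding F_def by (rule C1_closedI[OF Dpu]) (auto simp: F_def[abs_def] intro!: continuous_intros cont cont_uv)
  moreover have "deriv_on T1 T2 (\<lambda>t. p t * deriv_on T1 T2 u t) t = F t" if "t \<in> {T1..T2}" for t
    using deriv_on_eq[OF Dpu that] that by simp
  ultimately show "fucik_solution T1 T2 p q m n a b u"
    using assms(2,3) unfolding fucik_solution_def by (auto simp: F_def)
qed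

lemma C_gt_iff:
  "(a, b) \<in> C_gt T1 T2 p q m n k \<longleftrightarrow>
     (\<exists>u v. fucik_pair T1 T2 p q m n a b u v \<and> u T1 = 0 \<and> u T2 = 0 \<and>
        exactly_zeros T1 T2 (k - 1) u \<and> 0 < v T1)"
proof
  assume "(a, b) \<in> C_gt T1 T2 p q m n k"
  then obtain u where u: "fucik_solution T1 T2 p q m n a b u" "exactly_zeros T1 T2 (k - 1) u"
      "0 < deriv_on T1 T2 u T1"
    unfolding C_gt_def by auto
  moreover have "u T1 = 0" "u T2 = 0" "0 < p T1"
    using u(1) p_pos T by (auto simp: fucik_solution_def)
  ultimately show "\<exists>u v. fucik_pair T1 T2 p q m n a b u v \<and> u T1 = 0 \<and> u T2 = 0 \<and>
        exactly_zeros T1 T2 (k - 1) u \<and> 0 < v T1"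
    using fucik_solution_imp_pair[OF u(1)]
    by (intro exI[of _ u] exI[of _ "\<lambda>t. p t * deriv_on T1 T2 u t"]) simp
next
  assume "\<exists>u v. fucik_pair T1 T2 p q m n a b u v \<and> u T1 = 0 \<and> u T2 = 0 \<and>
        exactly_zeros T1 T2 (k - 1) u \<and> 0 < v T1"
  then obtain u v where uv: "fucik_pair T1 T2 p q m n a b u v" "u T1 = 0" "u T2 = 0"
        "exactly_zeros T1 T2 (k - 1) u" "0 < v T1" by blast
  have "0 < deriv_on T1 T2 u T1"
    using fucik_pair_imp_solution(2)[OF uv(1-3), of T1] T p_pos[of T1] uv(5) by auto
  then show "(a, b) \<in> C_gt T1 T2 p q m n k"
    unfolding C_gt_def using fucik_pair_imp_solution(1)[OF uv(1-3)] uv(4) by blast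
qed

lemma C_lt_iff:
  "(a, b) \<in> C_lt T1 T2 p q m n k \<longleftrightarrow>
     (\<exists>u v. fucik_pair T1 T2 p q m n a b u v \<and> u T1 = 0 \<and> u T2 = 0 \<and>
        exactly_zeros T1 T2 (k - 1) u \<and> v T1 < 0)"
proof
  assume "(a, b) \<in> C_lt T1 T2 p q m n k"
  then obtain u where u: "fucik_solution T1 T2 p q m n a b u" "exactly_zeros T1 T2 (k - 1) u"
      "deriv_on T1 T2 u T1 < 0"
    unfolding C_lt_def by auto
  moreover have "u T1 = 0" "u T2 = 0" "0 < p T1"
    using u(1) p_pos T by (auto simp: fucik_solution_def)
  ultimately show "\<exists>u v. fucik_pair T1 T2 p q m n a b u v \<and> u T1 = 0 \<and> u T2 = 0 \<and>
        exactly_zeros T1 T2 (k - 1) u \<and> v T1 < 0"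
    using fucik_solution_imp_pair[OF u(1)]
    by (intro exI[of _ u] exI[of _ "\<lambda>t. p t * deriv_on T1 T2 u t"]) (simp add: mult_pos_neg)
next
  assume "\<exists>u v. fucik_pair T1 T2 p q m n a b u v \<and> u T1 = 0 \<and> u T2 = 0 \<and>
        exactly_zeros T1 T2 (k - 1) u \<and> v T1 < 0"
  then obtain u v where uv: "fucik_pair T1 T2 p q m n a b u v" "u T1 = 0" "u T2 = 0"
        "exactly_zeros T1 T2 (k - 1) u" "v T1 < 0" by blast
  have "deriv_on T1 T2 u T1 < 0"
    using fucik_pair_imp_solution(2)[OF uv(1-3), of T1] T p_pos[of T1] uv(5) by (auto simp: divide_neg_pos)
  then show "(a, b) \<in> C_lt T1 T2 p q m n k"
    unfolding C_lt_def using fucik_pair_imp_solution(1)[OF uv(1-3)] uv(4) by blast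
qed

lemma fucik_pair_swap:
  assumes "fucik_pair T1 T2 p q m n a b u v"
  shows "fucik_pair T1 T2 p q n m b a (\<lambda>t. - u t) (\<lambda>t. - v t)"
  unfolding fucik_pair_def
proof (intro ballI conjI)
  fix t assume t: "t \<in> {T1..T2}"
  have D: "(u has_real_derivative v t / p t) (at t within {T1..T2})"
    "(v has_real_derivative q t * u t - a * m t * max (u t) 0 + b * n t * max (- u t) 0)
      (at t within {T1..T2})"
    using assms t unfolding fucik_pair_def by auto
  show "((\<lambda>t. - u t) has_real_derivative - v t / p t) (at t within {T1..T2})"
    using DERIV_minus[OF D(1)] by simp
  show "((\<lambda>t. - v t) has_real_derivative
      q t * - u t - b * n t * max (- u t) 0 + a * m t * max (- (- u t)) 0) (at t within {T1..T2})"
    using DERIV_minus[OF D(2)] by (simp add: algebra_simps)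
qed

text \<open>
  The map \<open>u \<mapsto> -u\<close> exchanges \<open>u\<^sup>+\<close> with \<open>u\<^sup>-\<close>, hence \<open>(a, m)\<close> with \<open>(b, n)\<close>, and reverses the initial slope.
\<close>
lemma C_lt_swap: "(a, b) \<in> C_lt T1 T2 p q m n k \<longleftrightarrow> (b, a) \<in> C_gt T1 T2 p q n m k"
proof -
  interpret S: fucik_problem T1 T2 p q n m
    by unfold_locales (use T cont p_pos q_nonneg in auto)
  show ?thesis
  proof
    assume "(a, b) \<in> C_lt T1 T2 p q m n k"
    then obtain u v where uv: "fucik_pair T1 T2 p q m n a b u v" "u T1 = 0" "u T2 = 0"
        "exactly_zeros T1 T2 (k - 1) u" "v T1 < 0"
      unfolding C_lt_iff by blast
    then show "(b, a) \<in> C_gt T1 T2 p q n m k"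
      unfolding S.C_gt_iff using fucik_pair_swap[OF uv(1)]
      by (intro exI[of _ "\<lambda>t. - u t"] exI[of _ "\<lambda>t. - v t"]) (simp add: exactly_zeros_def)
  next
    assume "(b, a) \<in> C_gt T1 T2 p q n m k"
    then obtain u v where uv: "fucik_pair T1 T2 p q n m b a u v" "u T1 = 0" "u T2 = 0"
        "exactly_zeros T1 T2 (k - 1) u" "0 < v T1"
      unfolding S.C_gt_iff by blast
    then show "(a, b) \<in> C_lt T1 T2 p q m n k"
      unfolding C_lt_iff using S.fucik_pair_swap[OF uv(1)]
      by (intro exI[of _ "\<lambda>t. - u t"] exI[of _ "\<lambda>t. - v t"]) (simp add: exactly_zeros_def)
  qed
qed

lemma fucik_pair_nonneg:
  assumes "fucik_pair T1 T2 p q m n a b u v" "T1 \<le> x" "y \<le> T2" "\<And>t. t \<in> {x..y} \<Longrightarrow> 0 \<le> u t"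
  shows "sl_pair x y p (\<lambda>t. q t - a * m t) u v"
  unfolding sl_pair_def
proof (intro ballI conjI)
  fix t assume t: "t \<in> {x..y}"
  then have tT: "t \<in> {T1..T2}" and sub: "{x..y} \<subseteq> {T1..T2}" using assms by auto
  have "(u has_real_derivative v t / p t) (at t within {T1..T2})"
    "(v has_real_derivative q t * u t - a * m t * max (u t) 0 + b * n t * max (- u t) 0)
      (at t within {T1..T2})"
    using assms(1) tT unfolding fucik_pair_def by auto
  note D = this[THEN DERIV_subset[OF _ sub]]
  show "(u has_real_derivative v t / p t) (at t within {x..y})" by (rule D(1))
  show "(v has_real_derivative (q t - a * m t) * u t) (at t within {x..y})"
    using D(2) assms(4)[OF t] by (simp add: algebra_simps)
qed

lemma fucik_pair_nonpos:
  assumes "fucik_pair T1 T2 p q m n a b u v" "T1 \<le> x" "y \<le> T2" "\<And>t. t \<in> {x..y} \<Longrightarrow> u t \<le> 0"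
  shows "sl_pair x y p (\<lambda>t. q t - b * n t) (\<lambda>t. - u t) (\<lambda>t. - v t)"
proof -
  interpret S: fucik_problem T1 T2 p q n m
    by unfold_locales (use T cont p_pos q_nonneg in auto)
  show ?thesis
    by (rule S.fucik_pair_nonneg[OF fucik_pair_swap[OF assms(1)]]) (use assms in auto)
qed

end

lemma nonzero_imp_constant_sign:
  fixes u :: "real \<Rightarrow> real"
  assumes "continuous_on {x..y} u" "\<And>t. t \<in> {x<..<y} \<Longrightarrow> u t \<noteq> 0"
  shows "(\<forall>t\<in>{x<..<y}. 0 < u t) \<or> (\<forall>t\<in>{x<..<y}. u t < 0)"
proof (rule ccontr)
  assume "\<not> ?thesis"
  then obtain r t where rt: "r \<in> {x<..<y}" "u r \<le> 0" "t \<in> {x<..<y}" "0 \<le> u t"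
    by (meson not_less)
  have "connected (u ` {x<..<y})"
    by (rule connected_continuous_image[OF continuous_on_subset[OF assms(1)]]) auto
  then have "0 \<in> u ` {x<..<y}"
    by (rule connectedD_interval[of _ "u r" "u t"]) (use rt in auto)
  then show False
    using assms(2) by auto
qed

lemma positive_right_of_zero:
  fixes u :: "real \<Rightarrow> real"
  assumes D: "(u has_real_derivative d) (at x within {x..z})" and "0 < d" "u x = 0" "x < y" "y \<le> z"
    and cont: "continuous_on {x..y} u" and nz: "\<And>t. t \<in> {x<..<y} \<Longrightarrow> u t \<noteq> 0" and t: "t \<in> {x<..<y}"
  shows "0 < u t"
proof -
  obtain e where e: "0 < e" "\<And>h. 0 < h \<Longrightarrow> x + h \<in> {x..z} \<Longrightarrow> h < e \<Longrightarrow> u x < u (x + h)"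
    using has_real_derivative_pos_inc_right[OF D \<open>0 < d\<close>] by blast
  define h where "h = min (e / 2) ((y - x) / 2)"
  have h: "0 < h" "h < e" "x + h \<in> {x<..<y}"
    using e(1) \<open>x < y\<close> by (auto simp: h_def min_def field_simps)
  then have "0 < u (x + h)"
    using e(2)[of h] \<open>u x = 0\<close> \<open>y \<le> z\<close> by auto
  moreover have "(\<forall>t\<in>{x<..<y}. 0 < u t) \<or> (\<forall>t\<in>{x<..<y}. u t < 0)"
    by (rule nonzero_imp_constant_sign[OF cont nz])
  ultimately show ?thesis
    using h(3) t by (meson less_asym)
qed

text \<open>
  The slope of a positive solution at an endpoint where it vanishes is nonzero by uniqueness, and its sign is then forced. Such
  simple zeros are what allows positive pieces to be glued.
\<close>
lemma positive_solution_slope_left: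
  assumes sl: "sl_pair x y p g u v" and "x < y"
    and cont: "continuous_on {x..y} p" "continuous_on {x..y} g"
    and pos: "\<And>t. t \<in> {x..y} \<Longrightarrow> 0 < p t"
    and u: "u x = 0" "\<And>t. t \<in> {x<..<y} \<Longrightarrow> 0 < u t"
  shows "0 < v x"
proof (rule ccontr)
  assume not: "\<not> 0 < v x"
  define c where "c = (x + y) / 2"
  have c: "c \<in> {x<..<y}"
    using \<open>x < y\<close> by (auto simp: c_def)
  have "v x \<noteq> 0"
    using sl_pair_unique_right[OF sl cont pos u(1), of c] u(2)[OF c] c by force
  with not have "v x < 0" by simp
  have D: "((\<lambda>t. - u t) has_real_derivative - (v x / p x)) (at x within {x..y})"
    using sl_pairD(1)[OF sl, of x] \<open>x < y\<close> by (intro DERIV_minus) auto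
  have "0 < - u c"
  proof (rule positive_right_of_zero[where u = "\<lambda>t. - u t" and t = c, OF D])
    show "0 < - (v x / p x)"
      using \<open>v x < 0\<close> pos[of x] \<open>x < y\<close> by (simp add: divide_neg_pos)
    show "continuous_on {x..y} (\<lambda>t. - u t)"
      by (intro continuous_intros sl_pair_continuous[OF sl])
    show "- u t \<noteq> 0" if "t \<in> {x<..<y}" for t
      using u(2)[OF that] by simp
  qed (use u(1) c \<open>x < y\<close> in auto)
  then show False
    using u(2)[OF c] by simp
qed

lemma positive_solution_slope_right:
  assumes sl: "sl_pair x y p g u v" and "x < y"
    and cont: "continuous_on {x..y} p" "continuous_on {x..y} g"
    and pos: "\<And>t. t \<in> {x..y} \<Longrightarrow> 0 < p t"
    and u: "u y = 0" "\<And>t. t \<in> {x<..<y} \<Longrightarrow> 0 < u t"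
  shows "v y < 0"
proof -
  have "0 < - v (- (- y))"
  proof (rule positive_solution_slope_left[OF sl_pair_reflect[OF sl]])
    show "continuous_on {-y..-x} (\<lambda>t. p (-t))" "continuous_on {-y..-x} (\<lambda>t. g (-t))"
      by (rule continuous_on_compose2[OF cont(1)] continuous_on_compose2[OF cont(2)];
          force intro!: continuous_intros)+
  qed (use u pos \<open>x < y\<close> in auto)
  then show ?thesis by simp
qed

lemma has_real_derivative_glue:
  fixes f g f' g' :: "real \<Rightarrow> real"
  assumes f: "\<And>t. t \<in> {x..s} \<Longrightarrow> (f has_real_derivative f' t) (at t within {x..s})"
    and g: "\<And>t. t \<in> {s..y} \<Longrightarrow> (g has_real_derivative g' t) (at t within {s..y})"
    and eq: "f s = g s" "f' s = g' s" and s: "x \<le> s" "s \<le> y" and t: "t \<in> {x..y}"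
  shows "((\<lambda>t. if t \<in> {x..s} then f t else g t) has_real_derivative
           (if t \<in> {x..s} then f' t else g' t)) (at t within {x..y})"
  unfolding has_real_derivative_iff_has_vector_derivative
proof (rule has_vector_derivative_If_within_closures[where T = "{s..y}"])
  have int: "{x..s} \<inter> {s..y} = {s}"
    using s by auto
  then have eqs: "{x..s} \<union> (closure {x..s} \<inter> closure {s..y}) = {x..s}"
    "{s..y} \<union> (closure {x..s} \<inter> closure {s..y}) = {s..y}"
    using s by auto
  show "(f has_vector_derivative f' t) (at t within {x..s} \<union> (closure {x..s} \<inter> closure {s..y}))"
    if "t \<in> {x..s} \<union> (closure {x..s} \<inter> closure {s..y})"
    using f that unfolding eqs has_real_derivative_iff_has_vector_derivative by blast
  show "(g has_vector_derivative g' t) (at t within {s..y} \<union> (closure {x..s} \<inter> closure {s..y}))"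
    if "t \<in> {s..y} \<union> (closure {x..s} \<inter> closure {s..y})"
    using g that unfolding eqs has_real_derivative_iff_has_vector_derivative by blast
  show "f t = g t" "f' t = g' t" if "t \<in> closure {x..s}" "t \<in> closure {s..y}"
  proof -
    have "t = s"
      using that by auto
    then show "f t = g t" "f' t = g' t"
      using eq by simp_all
  qed
qed (use t s in auto)

context fucik_problem
begin

lemma cont_coeffs:
  assumes "T1 \<le> x" "y \<le> T2"
  shows "continuous_on {x..y} p" "continuous_on {x..y} (\<lambda>t. q t - a * m t)"
    "continuous_on {x..y} (\<lambda>t. q t - b * n t)"
proof -
  have "{x..y} \<subseteq> {T1..T2}" using assms by auto
  note sub = continuous_on_subset[OF _ this]
  show "continuous_on {x..y} p" "continuous_on {x..y} (\<lambda>t. q t - a * m t)"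
    "continuous_on {x..y} (\<lambda>t. q t - b * n t)"
    by (intro continuous_intros sub[OF cont(1)] sub[OF cont(2)] sub[OF cont(3)] sub[OF cont(4)])+
qed

lemma fucik_pair_continuous:
  assumes "fucik_pair T1 T2 p q m n a b u v"
  shows "continuous_on {T1..T2} u"
  by (rule DERIV_continuous_on[where D = "\<lambda>t. v t / p t"]) (use assms in \<open>simp add: fucik_pair_def\<close>)

lemma fucik_pair_positive:
  assumes uv: "fucik_pair T1 T2 p q m n a b u v" and "u T1 = 0" "0 < v T1" "T1 < y" "y \<le> T2"
    and nz: "\<And>t. t \<in> {T1<..<y} \<Longrightarrow> u t \<noteq> 0" and t: "t \<in> {T1<..<y}"
  shows "0 < u t"
proof (rule positive_right_of_zero[where u = u and t = t and x = T1 and y = y and z = T2 and d = "v T1 / p T1"])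
  show "(u has_real_derivative v T1 / p T1) (at T1 within {T1..T2})"
    using uv T by (auto simp: fucik_pair_def)
  show "0 < v T1 / p T1"
    using assms(3) p_pos[of T1] T by simp
  show "continuous_on {T1..y} u"
    by (rule continuous_on_subset[OF fucik_pair_continuous[OF uv]]) (use \<open>y \<le> T2\<close> in auto)
qed (use assms in auto)

lemma C_gt_1_imp_positive_solution:
  assumes "(a, b) \<in> C_gt T1 T2 p q m n 1"
  shows "positive_solution T1 T2 p (\<lambda>t. q t - a * m t)"
proof -
  obtain u v where uv: "fucik_pair T1 T2 p q m n a b u v" "u T1 = 0" "u T2 = 0"
      "exactly_zeros T1 T2 0 u" "0 < v T1"
    using assms unfolding C_gt_iff by auto
  have "u t \<noteq> 0" if "t \<in> {T1<..<T2}" for t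
    using uv(4) that by (auto simp: exactly_zeros_def)
  then have pos: "0 < u t" if "t \<in> {T1<..<T2}" for t
    using fucik_pair_positive[OF uv(1,2,5) T] that by auto
  have "0 \<le> u t" if "t \<in> {T1..T2}" for t
    using pos[of t] that uv(2,3) by (cases "t = T1 \<or> t = T2") (auto intro: less_imp_le)
  then have "sl_pair T1 T2 p (\<lambda>t. q t - a * m t) u v"
    by (intro fucik_pair_nonneg[OF uv(1)]) auto
  then show ?thesis
    unfolding positive_solution_def using uv(2,3) pos by blast
qed

text \<open>
  At its only interior zero \<open>s\<close> the solution must change sign: otherwise it would be nonnegative, so it would solve the linear
  equation \<open>Lu = a m u\<close> on the whole interval, with a minimum at \<open>s\<close> and therefore with vanishing data there.
\<close>
lemma C_gt_2_imp_positive_solutions: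
  assumes "(a, b) \<in> C_gt T1 T2 p q m n 2"
  shows "\<exists>s\<in>{T1<..<T2}. positive_solution T1 s p (\<lambda>t. q t - a * m t) \<and>
           positive_solution s T2 p (\<lambda>t. q t - b * n t)"
proof -
  obtain u v where uv: "fucik_pair T1 T2 p q m n a b u v" "u T1 = 0" "u T2 = 0"
      "exactly_zeros T1 T2 1 u" "0 < v T1"
    using assms unfolding C_gt_iff by auto
  obtain s where "{t \<in> {T1<..<T2}. u t = 0} = {s}"
    using uv(4) unfolding exactly_zeros_def by (metis card_1_singletonE)
  then have s: "s \<in> {T1<..<T2}" "u s = 0"
    and only: "\<And>t. t \<in> {T1<..<T2} \<Longrightarrow> u t = 0 \<Longrightarrow> t = s" by blast+
  have left: "0 < u t" if "t \<in> {T1<..<s}" for t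
  proof (rule fucik_pair_positive[OF uv(1,2,5)])
    show "u r \<noteq> 0" if "r \<in> {T1<..<s}" for r
      using only[of r] s that by auto
  qed (use s that in auto)
  have "continuous_on {s..T2} u"
    by (rule continuous_on_subset[OF fucik_pair_continuous[OF uv(1)]]) (use s in auto)
  moreover have "u t \<noteq> 0" if "t \<in> {s<..<T2}" for t
    using only[of t] s that by auto
  ultimately have "(\<forall>t\<in>{s<..<T2}. 0 < u t) \<or> (\<forall>t\<in>{s<..<T2}. u t < 0)"
    by (rule nonzero_imp_constant_sign)
  moreover have "\<not> (\<forall>t\<in>{s<..<T2}. 0 < u t)"
  proof
    assume right: "\<forall>t\<in>{s<..<T2}. 0 < u t"
    have nonneg: "0 \<le> u t" if "t \<in> {T1..T2}" for t
      using left[of t] right that uv(2,3) s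
      by (cases "t = T1 \<or> t = s \<or> t = T2"; cases "t < s") (auto intro: less_imp_le)
    then have sl: "sl_pair T1 T2 p (\<lambda>t. q t - a * m t) u v"
      by (intro fucik_pair_nonneg[OF uv(1)]) auto
    have "v s / p s = 0"
    proof (rule DERIV_local_min[OF sl_pair_DERIV(1)[OF sl s(1)]])
      show "0 < min (s - T1) (T2 - s)"
        using s by simp
      show "\<forall>y. \<bar>s - y\<bar> < min (s - T1) (T2 - s) \<longrightarrow> u s \<le> u y"
      proof (intro allI impI)
        fix r assume "\<bar>s - r\<bar> < min (s - T1) (T2 - s)"
        then have "r \<in> {T1..T2}" by auto
        then show "u s \<le> u r"
          using nonneg s(2) by simp
      qed
    qed
    then have "v s = 0"
      using p_pos[of s] s by auto
    then have "v T1 = 0"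
      using sl_pair_unique[OF sl cont_coeffs(1,2) p_pos, of s T1] s T by auto
    with uv(5) show False by simp
  qed
  ultimately have right: "u t < 0" if "t \<in> {s<..<T2}" for t
    using that by blast
  have "0 \<le> u t" if "t \<in> {T1..s}" for t
    using left[of t] that uv(2) s(2) by (cases "t = T1 \<or> t = s") (auto intro: less_imp_le)
  then have sl1: "sl_pair T1 s p (\<lambda>t. q t - a * m t) u v"
    using s by (intro fucik_pair_nonneg[OF uv(1)]) auto
  have "u t \<le> 0" if "t \<in> {s..T2}" for t
    using right[of t] that uv(3) s(2) by (cases "t = T2 \<or> t = s") (auto intro: less_imp_le)
  then have sl2: "sl_pair s T2 p (\<lambda>t. q t - b * n t) (\<lambda>t. - u t) (\<lambda>t. - v t)"
    using s by (intro fucik_pair_nonpos[OF uv(1)]) auto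
  have "positive_solution T1 s p (\<lambda>t. q t - a * m t)"
    unfolding positive_solution_def using sl1 uv(2) s(2) left by blast
  moreover have "positive_solution s T2 p (\<lambda>t. q t - b * n t)"
    unfolding positive_solution_def using sl2 uv(3) s(2) right
    by (intro exI[of _ "\<lambda>t. - u t"] exI[of _ "\<lambda>t. - v t"]) auto
  ultimately show ?thesis
    using s(1) by blast
qed

text \<open>
  The right piece is multiplied by the negative factor \<open>k\<close> that matches the quasi-derivatives at \<open>s\<close>.
\<close>
lemma positive_solutions_imp_C_gt_2:
  assumes s: "s \<in> {T1<..<T2}" and left: "positive_solution T1 s p (\<lambda>t. q t - a * m t)"
    and right: "positive_solution s T2 p (\<lambda>t. q t - b * n t)"
  shows "(a, b) \<in> C_gt T1 T2 p q m n 2"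
proof -
  obtain u1 v1 where uv1: "sl_pair T1 s p (\<lambda>t. q t - a * m t) u1 v1" "u1 T1 = 0" "u1 s = 0"
      "\<And>t. t \<in> {T1<..<s} \<Longrightarrow> 0 < u1 t"
    using left unfolding positive_solution_def by blast
  obtain u2 v2 where uv2: "sl_pair s T2 p (\<lambda>t. q t - b * n t) u2 v2" "u2 s = 0" "u2 T2 = 0"
      "\<And>t. t \<in> {s<..<T2} \<Longrightarrow> 0 < u2 t"
    using right unfolding positive_solution_def by blast
  have v1: "0 < v1 T1" "v1 s < 0"
    using positive_solution_slope_left[OF uv1(1) _ cont_coeffs(1,2) _ uv1(2,4)]
      positive_solution_slope_right[OF uv1(1) _ cont_coeffs(1,2) _ uv1(3,4)] s p_pos by auto
  have v2: "0 < v2 s"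
    using positive_solution_slope_left[OF uv2(1) _ cont_coeffs(1,3) _ uv2(2,4)] s p_pos by auto
  define k where "k = v1 s / v2 s"
  have k: "k < 0" "k * v2 s = v1 s"
    using v1 v2 by (auto simp: k_def divide_neg_pos)
  note sl2 = sl_pair_scale[OF uv2(1), of k]
  define u where "u t = (if t \<in> {T1..s} then u1 t else k * u2 t)" for t
  define v where "v t = (if t \<in> {T1..s} then v1 t else k * v2 t)" for t
  have sg1: "0 \<le> u1 t" if "t \<in> {T1..s}" for t
    using uv1(2-4) that by (cases "t = T1 \<or> t = s") (auto intro: less_imp_le)
  have sg2: "k * u2 t < 0" if "t \<in> {s<..<T2}" for t
    using uv2(4)[OF that] k(1) by (simp add: mult_neg_pos)
  have sg2': "k * u2 t \<le> 0" if "t \<in> {s..T2}" for t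
    using sg2[of t] uv2(2,3) that by (cases "t = T2 \<or> t = s") (auto intro: less_imp_le)
  have "fucik_pair T1 T2 p q m n a b u v"
    unfolding fucik_pair_def
  proof (intro ballI conjI)
    fix t assume t: "t \<in> {T1..T2}"
    have "(u has_real_derivative (if t \<in> {T1..s} then v1 t / p t else k * v2 t / p t)) (at t within {T1..T2})"
      unfolding u_def
      by (rule has_real_derivative_glue[OF sl_pairD(1)[OF uv1(1)] sl_pairD(1)[OF sl2]])
        (use uv1(3) uv2(2) k s t in auto)
    then show "(u has_real_derivative v t / p t) (at t within {T1..T2})"
      by (simp add: v_def if_distrib[where f = "\<lambda>z. z / p t"] cong: if_cong)
    have "(v has_real_derivative (if t \<in> {T1..s} then (q t - a * m t) * u1 t else (q t - b * n t) * (k * u2 t)))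
        (at t within {T1..T2})"
      unfolding v_def
      by (rule has_real_derivative_glue[OF sl_pairD(2)[OF uv1(1)] sl_pairD(2)[OF sl2]])
        (use uv1(3) uv2(2) k s t in auto)
    also have "(if t \<in> {T1..s} then (q t - a * m t) * u1 t else (q t - b * n t) * (k * u2 t)) =
        q t * u t - a * m t * max (u t) 0 + b * n t * max (- u t) 0"
      using sg1[of t] sg2'[of t] t by (auto simp: u_def algebra_simps max_absorb1 max_absorb2)
    finally show "(v has_real_derivative q t * u t - a * m t * max (u t) 0 + b * n t * max (- u t) 0)
        (at t within {T1..T2})" .
  qed
  moreover have "u T1 = 0" "u T2 = 0" "0 < v T1"
    using s uv1(2) uv2(3) v1(1) by (auto simp: u_def v_def)
  moreover have "{t \<in> {T1<..<T2}. u t = 0} = {s}"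
  proof -
    have "u t \<noteq> 0" if "t \<in> {T1<..<T2}" "t \<noteq> s" for t
      using uv1(4)[of t] sg2[of t] that by (cases "t < s") (auto simp: u_def)
    moreover have "u s = 0"
      using s uv1(3) by (auto simp: u_def)
    ultimately show ?thesis
      using s by blast
  qed
  then have "exactly_zeros T1 T2 (2 - 1) u"
    by (simp add: exactly_zeros_def)
  ultimately show ?thesis
    unfolding C_gt_iff by blast
qed

text \<open>
  The hypotheses say that \<open>c < s0 < d\<close>, where \<open>c\<close> is the onset of \<open>m\<close> from the left and \<open>d\<close> that of \<open>n\<close> from the
  right. The curve is the image of \<open>]c, d[\<close> under the pair of principal eigenvalues of \<open>[T1, s]\<close> and \<open>[s, T2]\<close>. It
  avoids the trivial lines because these belong to \<open>s = T2\<close> and \<open>s = T1\<close>, and both eigenvalues are strictly monotone.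
\<close>
lemma second_curve_in_positive_quadrant:
  assumes s0: "s0 \<in> {T1<..<T2}" and m: "\<exists>t\<in>{T1<..<s0}. 0 < m t" and n: "\<exists>t\<in>{s0<..<T2}. 0 < n t"
  defines "C \<equiv> C_gt T1 T2 p q m n 2 \<inter> {0<..} \<times> {0<..}"
  shows "C \<noteq> {}" and "hyperbolic_like_pos C" and "hyperbolic_like_pos (prod.swap ` C)"
    and "(a, b) \<in> C \<Longrightarrow> (a, b) \<notin> C_gt T1 T2 p q m n 1 \<and> (a, b) \<notin> C_lt T1 T2 p q m n 1"
proof -
  interpret L: sturm_liouville T1 T2 p q m
    by unfold_locales (use T cont p_pos q_nonneg in auto)
  have refl: "continuous_on {-T2..-T1} (\<lambda>t. f (-t))" if "continuous_on {T1..T2} f" for f :: "real \<Rightarrow> real"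
    by (intro continuous_on_compose2[OF that] continuous_intros) auto
  interpret R: sturm_liouville "-T2" "-T1" "\<lambda>t. p (-t)" "\<lambda>t. q (-t)" "\<lambda>t. n (-t)"
    by unfold_locales (use T cont p_pos q_nonneg in \<open>auto intro: refl\<close>)
  interpret S: fucik_problem T1 T2 p q n m
    by unfold_locales (use T cont p_pos q_nonneg in auto)
  have mL: "\<exists>t\<in>{T1<..<T2}. 0 < m t"
    using m s0 by force
  have nR': "\<exists>t\<in>{-T2<..<-s0}. 0 < n (-t)"
    using n by (metis (no_types, lifting) greaterThanLessThan_iff minus_less_iff minus_minus neg_less_iff_less)
  have nR: "\<exists>t\<in>{-T2<..<-T1}. 0 < n (-t)"
    using nR' s0 by force
  define c where "c = L.onset"
  define d where "d = - R.onset"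
  have cd: "T1 \<le> c" "c < s0" "s0 < d" "d \<le> T2"
    using L.onset_bounds[OF mL] R.onset_bounds[OF nR] L.onset_less_iff[OF mL, of s0] m
      R.onset_less_iff[OF nR, of "-s0"] nR' s0 by (auto simp: c_def d_def)
  define x where "x = L.eigval"
  define y where "y s = R.eigval (-s)" for s
  have left: "positive_solution T1 s p (\<lambda>t. q t - a * m t) \<longleftrightarrow> c < s \<and> a = x s"
    if "s \<in> {T1<..T2}" "0 < a" for s a
    unfolding c_def x_def by (rule L.positive_solution_iff_eigval[OF mL that])
  have right: "positive_solution s T2 p (\<lambda>t. q t - b * n t) \<longleftrightarrow> s < d \<and> b = y s"
    if "s \<in> {T1..<T2}" "0 < b" for s b
    unfolding positive_solution_reflect_iff[of s] d_def y_def
    using R.positive_solution_iff_eigval[OF nR, of "-s" b] that by auto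
  have x_less: "x t < x s" if "c < s" "s < t" "t \<le> T2" for s t
    unfolding x_def by (rule L.eigval_less[OF mL]) (use that in \<open>auto simp: c_def\<close>)
  have y_less: "y s < y t" if "T1 \<le> s" "s < t" "t < d" for s t
    unfolding y_def by (rule R.eigval_less[OF nR]) (use that in \<open>auto simp: d_def\<close>)
  have pos: "0 < x s" "0 < y s" if "s \<in> {c<..<d}" for s
    unfolding x_def y_def using that cd
    by (auto intro!: L.eigval_pos[OF mL] R.eigval_pos[OF nR] simp: c_def d_def)
  have C_iff: "z \<in> C \<longleftrightarrow> (\<exists>s\<in>{c<..<d}. z = (x s, y s))" for z
  proof
    assume "z \<in> C"
    then obtain a b where ab: "z = (a, b)" "0 < a" "0 < b" "(a, b) \<in> C_gt T1 T2 p q m n 2"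
      by (auto simp: C_def)
    then obtain s where "s \<in> {T1<..<T2}" "positive_solution T1 s p (\<lambda>t. q t - a * m t)"
        "positive_solution s T2 p (\<lambda>t. q t - b * n t)"
      using C_gt_2_imp_positive_solutions by blast
    then show "\<exists>s\<in>{c<..<d}. z = (x s, y s)"
      using left[of s a] right[of s b] ab by (intro bexI[of _ s]) auto
  next
    assume "\<exists>s\<in>{c<..<d}. z = (x s, y s)"
    then obtain s where s: "s \<in> {c<..<d}" "z = (x s, y s)" by blast
    then have "positive_solution T1 s p (\<lambda>t. q t - x s * m t)"
        "positive_solution s T2 p (\<lambda>t. q t - y s * n t)"
      using left[of s "x s"] right[of s "y s"] pos[OF s(1)] cd by auto
    then have "(x s, y s) \<in> C_gt T1 T2 p q m n 2"
      using s(1) cd by (intro positive_solutions_imp_C_gt_2[of s]) auto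
    then show "z \<in> C"
      using pos[OF s(1)] s(2) by (simp add: C_def)
  qed
  then have C_eq: "C = (\<lambda>s. (x s, y s)) ` {c<..<d}"
    by blast
  have C_swap_eq: "prod.swap ` C = (\<lambda>s. (y s, x s)) ` {c<..<d}"
    by (simp add: C_eq image_image)
  show "C \<noteq> {}"
    using C_eq cd by auto
  have img_x: "x ` {c<..<d} = {x d<..}"
    unfolding x_def c_def by (rule L.eigval_image[OF mL]) (use cd in \<open>auto simp: c_def\<close>)
  have "y ` {c<..<d} = R.eigval ` uminus ` {c<..<d}"
    unfolding y_def by (simp only: image_image)
  also have "\<dots> = {y c<..}"
    using R.eigval_image[OF nR, of "-c"] cd by (simp add: d_def y_def)
  finally have img_y: "y ` {c<..<d} = {y c<..}" .
  define x' where "x' = L.eigval_deriv"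
  define y' where "y' s = - R.eigval_deriv (-s)" for s
  have nonneg: "0 \<le> x d" "0 \<le> y c"
    unfolding x_def y_def using cd
    by (auto intro!: less_imp_le L.eigval_pos[OF mL] R.eigval_pos[OF nR] simp: c_def d_def)
  have Dx: "(x has_real_derivative x' s) (at s)" and neg: "x' s < 0" if "s \<in> {c<..<d}" for s
    unfolding x_def x'_def using that cd
    by (auto intro!: L.eigval_DERIV[OF mL] L.eigval_deriv_neg[OF mL] simp: c_def)
  have Dy: "(y has_real_derivative y' s) (at s)" and pos': "0 < y' s" if "s \<in> {c<..<d}" for s
  proof -
    have s: "-s \<in> {R.onset<..<-T1}"
      using that cd by (auto simp: d_def)
    show "(y has_real_derivative y' s) (at s)"
      using R.eigval_DERIV[OF nR s] unfolding y_def y'_def by (simp add: DERIV_mirror)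
    show "0 < y' s"
      using R.eigval_deriv_neg[OF nR s] by (simp add: y'_def)
  qed
  have cx: "continuous_on {c<..<d} x'"
    unfolding x'_def
    by (rule continuous_on_subset[OF L.continuous_on_eigval_deriv[OF mL]]) (use cd in \<open>auto simp: c_def\<close>)
  have cy: "continuous_on {c<..<d} y'"
    unfolding y'_def
    by (intro continuous_intros continuous_on_compose2[OF R.continuous_on_eigval_deriv[OF nR]])
      (use cd in \<open>auto simp: d_def\<close>)
  have "c < d" using cd by simp
  show "hyperbolic_like_pos C"
    unfolding C_eq
    by (rule hyperbolic_like_pos_parametrized[OF \<open>c < d\<close> img_x img_y nonneg Dx Dy neg pos' cx cy])
  show "hyperbolic_like_pos (prod.swap ` C)"
    unfolding C_swap_eq
    by (rule hyperbolic_like_pos_swap_parametrized[OF \<open>c < d\<close> img_x img_y nonneg Dx Dy neg pos' cx cy])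
  show "(a, b) \<notin> C_gt T1 T2 p q m n 1 \<and> (a, b) \<notin> C_lt T1 T2 p q m n 1" if ab: "(a, b) \<in> C"
  proof (intro conjI notI)
    obtain s where s: "s \<in> {c<..<d}" "a = x s" "b = y s"
      using ab unfolding C_eq by auto
    show False if "(a, b) \<in> C_gt T1 T2 p q m n 1"
    proof -
      have "T2 \<in> {T1<..T2}" "0 < a"
        using T pos(1)[OF s(1)] s(2) by simp_all
      from left[OF this] have "x s = x T2"
        using C_gt_1_imp_positive_solution[OF that] s(2) by simp
      then show False
        using x_less[of s T2] s(1) cd by simp
    qed
    show False if "(a, b) \<in> C_lt T1 T2 p q m n 1"
    proof -
      have "(b, a) \<in> C_gt T1 T2 p q n m 1"
        by (rule C_lt_swap[THEN iffD1, OF that])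
      note sol = S.C_gt_1_imp_positive_solution[OF this]
      have "T1 \<in> {T1..<T2}" "0 < b"
        using T pos(2)[OF s(1)] s(3) by simp_all
      from right[OF this] have "y s = y T1"
        using sol s(3) by simp
      then show False
        using y_less[of T1 s] s(1) cd by simp
    qed
  qed
qed

end

section \<open>The four quadrants\<close>

lemma fucik_solution_scale_weights:
  "fucik_solution T1 T2 p q (\<lambda>t. \<sigma> * m t) (\<lambda>t. \<tau> * n t) a b u \<longleftrightarrow>
     fucik_solution T1 T2 p q m n (\<sigma> * a) (\<tau> * b) u"
  unfolding fucik_solution_def by (simp add: mult_ac)

lemma C_gt_scale_weights:
  "(a, b) \<in> C_gt T1 T2 p q (\<lambda>t. \<sigma> * m t) (\<lambda>t. \<tau> * n t) k \<longleftrightarrow> (\<sigma> * a, \<tau> * b) \<in> C_gt T1 T2 p q m n k"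
  unfolding C_gt_def by (simp add: fucik_solution_scale_weights)

lemma C_lt_scale_weights:
  "(a, b) \<in> C_lt T1 T2 p q (\<lambda>t. \<sigma> * m t) (\<lambda>t. \<tau> * n t) k \<longleftrightarrow> (\<sigma> * a, \<tau> * b) \<in> C_lt T1 T2 p q m n k"
  unfolding C_lt_def by (simp add: fucik_solution_scale_weights)

lemma C_subset_fucik_spectrum:
  assumes "T1 < T2"
  shows "C_gt T1 T2 p q m n k \<union> C_lt T1 T2 p q m n k \<subseteq> fucik_spectrum T1 T2 p q m n"
proof -
  have "\<exists>t\<in>{T1..T2}. u t \<noteq> 0" if "exactly_zeros T1 T2 j u" for j u
  proof (rule ccontr)
    assume "\<not> ?thesis"
    then have "{t \<in> {T1<..<T2}. u t = 0} = {T1<..<T2}" by auto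
    then show False
      using that assms by (simp add: exactly_zeros_def infinite_Ioo)
  qed
  then show ?thesis
    unfolding C_gt_def C_lt_def fucik_spectrum_def by blast
qed

text \<open>
  This makes room for a zero of the solution between two points where the weights are positive, in case
  the points coincide.
\<close>
lemma positive_at_earlier_point:
  fixes f :: "real \<Rightarrow> real"
  assumes "continuous_on {x..y} f" "t \<in> {x<..<y}" "0 < f t"
  shows "\<exists>r\<in>{x<..<t}. 0 < f r"
proof -
  have "(f \<longlongrightarrow> f t) (at t)"
    using continuous_on_interior[OF assms(1), of t] assms(2) by (simp add: isCont_def)
  then have "(f \<longlongrightarrow> f t) (at_left t)"
    by (rule tendsto_within_subset) simp
  then have "eventually (\<lambda>r. 0 < f r) (at_left t)"
    using assms(3) by (rule order_tendstoD)
  moreover have "eventually (\<lambda>r. r \<in> {x<..<t}) (at_left t)"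
    using assms(2) by (intro eventually_at_leftI[of x]) auto
  ultimately have "eventually (\<lambda>r. r \<in> {x<..<t} \<and> 0 < f r) (at_left t)"
    by eventually_elim simp
  from eventually_happens[OF this] show ?thesis
    by (auto simp: trivial_limit_at_left_real)
qed

lemma fucik_problem_scale_weights:
  assumes "fucik_problem T1 T2 p q m n"
  shows "fucik_problem T1 T2 p q (\<lambda>t. \<sigma> * m t) (\<lambda>t. \<tau> * n t)"
proof -
  interpret fucik_problem T1 T2 p q m n by (rule assms)
  show ?thesis
    by unfold_locales (use T p_pos q_nonneg in \<open>auto intro!: continuous_intros cont\<close>)
qed

definition quadrant :: "real \<Rightarrow> real \<Rightarrow> (real \<times> real) set" where
  "quadrant \<sigma> \<tau> = {(a, b). 0 < \<sigma> * a \<and> 0 < \<tau> * b}"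

text \<open>
  For the weights \<open>\<sigma> m\<close> and \<open>\<tau> n\<close>, either some positive value of the first lies to the left of a positive value of
  the second, and the curve consists of solutions that start positive, or the order is reversed, and it
  consists of solutions that start negative. The reflection \<open>S\<close> carries the curve back to the quadrant with signs \<open>(\<sigma>, \<tau>)\<close>.
\<close>
lemma second_curve_in_quadrant:
  assumes FP: "fucik_problem T1 T2 p q m n" and sgn: "\<sigma> \<in> {1, -1}" "\<tau> \<in> {1, -1}"
    and m: "\<exists>t\<in>{T1<..<T2}. 0 < \<sigma> * m t" and n: "\<exists>t\<in>{T1<..<T2}. 0 < \<tau> * n t"
  shows "\<exists>C\<in>{C_gt T1 T2 p q m n 2 \<inter> quadrant \<sigma> \<tau>, C_lt T1 T2 p q m n 2 \<inter> quadrant \<sigma> \<tau>}.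
           C \<noteq> {} \<and> hyperbolic_like C \<and> C \<subseteq> fucik_spectrum_star T1 T2 p q m n"
proof -
  define m' n' where "m' t = \<sigma> * m t" and "n' t = \<tau> * n t" for t
  have F1: "fucik_problem T1 T2 p q m' n'"
    unfolding m'_def n'_def by (rule fucik_problem_scale_weights[OF FP])
  interpret F1: fucik_problem T1 T2 p q m' n' by (rule F1)
  interpret F2: fucik_problem T1 T2 p q n' m'
    by unfold_locales (use F1.T F1.cont F1.p_pos F1.q_nonneg in auto)
  have sq: "\<sigma> * (\<sigma> * z) = z" "\<tau> * (\<tau> * z) = z" for z
    using sgn by auto
  define S where "S z = (case z of (a, b) \<Rightarrow> (\<sigma> * a, \<tau> * b))" for z :: "real \<times> real"
  have SS: "S (S z) = z" for z
    by (simp add: S_def sq split: prod.split)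
  have gt: "S z \<in> C_gt T1 T2 p q m n k \<longleftrightarrow> z \<in> C_gt T1 T2 p q m' n' k"
    and lt: "S z \<in> C_lt T1 T2 p q m n k \<longleftrightarrow> z \<in> C_lt T1 T2 p q m' n' k" for z k
    unfolding S_def m'_def n'_def by (auto simp: C_gt_scale_weights C_lt_scale_weights split: prod.split)
  have quad: "S z \<in> quadrant \<sigma> \<tau> \<longleftrightarrow> z \<in> {0<..} \<times> {0<..}" for z
    by (auto simp: S_def quadrant_def sq split: prod.splits)
  have image_S: "S ` (A \<inter> quadrant \<sigma> \<tau>) = B \<inter> {0<..} \<times> {0<..}"
    if "\<And>z. S z \<in> A \<longleftrightarrow> z \<in> B" for A B
  proof (intro equalityI subsetI)
    fix z assume "z \<in> S ` (A \<inter> quadrant \<sigma> \<tau>)"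
    then obtain w where w: "z = S w" "w \<in> A" "w \<in> quadrant \<sigma> \<tau>" by blast
    then have "S z = w" by (simp add: SS)
    then show "z \<in> B \<inter> {0<..} \<times> {0<..}"
      using w that[of z] quad[of z] by simp
  next
    fix z assume "z \<in> B \<inter> {0<..} \<times> {0<..}"
    then have "S z \<in> A \<inter> quadrant \<sigma> \<tau>"
      using that[of z] quad[of z] by simp
    then show "z \<in> S ` (A \<inter> quadrant \<sigma> \<tau>)"
      by (metis SS imageI)
  qed
  have hyp: "hyperbolic_like A" if "hyperbolic_like_pos (S ` A)" for A
    unfolding hyperbolic_like_def using that sgn unfolding S_def by blast
  have spec: "A \<subseteq> fucik_spectrum_star T1 T2 p q m n"
    if "A \<subseteq> C_gt T1 T2 p q m n 2 \<union> C_lt T1 T2 p q m n 2"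
      and "\<And>z. z \<in> S ` A \<Longrightarrow> z \<notin> C_gt T1 T2 p q m' n' 1 \<and> z \<notin> C_lt T1 T2 p q m' n' 1" for A
  proof
    fix z assume z: "z \<in> A"
    then have "z \<notin> C_gt T1 T2 p q m n 1" "z \<notin> C_lt T1 T2 p q m n 1"
      using that(2)[of "S z"] gt[of "S z" 1] lt[of "S z" 1] by (auto simp: SS)
    moreover have "z \<in> fucik_spectrum T1 T2 p q m n"
      using C_subset_fucik_spectrum[OF F1.T] that(1) z by blast
    ultimately show "z \<in> fucik_spectrum_star T1 T2 p q m n"
      by (simp add: fucik_spectrum_star_def)
  qed
  obtain t1 where t1: "t1 \<in> {T1<..<T2}" "0 < m' t1"
    using m by (auto simp: m'_def)
  obtain t2 where t2: "t2 \<in> {T1<..<T2}" "0 < n' t2"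
    using n by (auto simp: n'_def)
  \<comment> \<open>In the reversed case \<open>t2 \<le> t1\<close> allows equality, so a point \<open>r2 < t2\<close> is needed to fit a zero \<open>s\<close> in between.\<close>
  obtain r2 where r2: "r2 \<in> {T1<..<t2}" "0 < n' r2"
    using positive_at_earlier_point[OF F1.cont(4) t2] by blast
  show ?thesis
  proof (cases "t1 < t2")
    case True
    define s where "s = (t1 + t2) / 2"
    have "t1 \<in> {T1<..<s}" "t2 \<in> {s<..<T2}" and "s \<in> {T1<..<T2}"
      using t1 t2 True by (auto simp: s_def)
    then have s: "s \<in> {T1<..<T2}" "\<exists>t\<in>{T1<..<s}. 0 < m' t" "\<exists>t\<in>{s<..<T2}. 0 < n' t"
      using t1 t2 by blast+
    note curve = F1.second_curve_in_positive_quadrant[OF s]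
    define C where "C = C_gt T1 T2 p q m n 2 \<inter> quadrant \<sigma> \<tau>"
    have SC: "S ` C = C_gt T1 T2 p q m' n' 2 \<inter> {0<..} \<times> {0<..}"
      unfolding C_def by (rule image_S[OF gt])
    have "C \<noteq> {}"
      using curve(1) SC by auto
    moreover have "hyperbolic_like C"
      by (rule hyp) (simp only: SC curve(2))
    moreover have "C \<subseteq> fucik_spectrum_star T1 T2 p q m n"
    proof (rule spec)
      show "z \<notin> C_gt T1 T2 p q m' n' 1 \<and> z \<notin> C_lt T1 T2 p q m' n' 1" if "z \<in> S ` C" for z
        using curve(4)[of "fst z" "snd z"] that unfolding SC by simp
    qed (auto simp: C_def)
    ultimately show ?thesis
      unfolding C_def by blast
  next
    case False
    define s where "s = (r2 + t1) / 2"
    have "r2 < t1" using r2 False by auto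
    then have "r2 \<in> {T1<..<s}" "t1 \<in> {s<..<T2}" and "s \<in> {T1<..<T2}"
      using t1 r2 by (auto simp: s_def)
    then have s: "s \<in> {T1<..<T2}" "\<exists>t\<in>{T1<..<s}. 0 < n' t" "\<exists>t\<in>{s<..<T2}. 0 < m' t"
      using t1 r2 by blast+
    note curve = F2.second_curve_in_positive_quadrant[OF s]
    define C where "C = C_lt T1 T2 p q m n 2 \<inter> quadrant \<sigma> \<tau>"
    have SC: "S ` C = C_lt T1 T2 p q m' n' 2 \<inter> {0<..} \<times> {0<..}"
      unfolding C_def by (rule image_S[OF lt])
    also have "\<dots> = prod.swap ` (C_gt T1 T2 p q n' m' 2 \<inter> {0<..} \<times> {0<..})"
    proof (intro equalityI subsetI)
      fix z assume "z \<in> C_lt T1 T2 p q m' n' 2 \<inter> {0<..} \<times> {0<..}"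
      then show "z \<in> prod.swap ` (C_gt T1 T2 p q n' m' 2 \<inter> {0<..} \<times> {0<..})"
        using F1.C_lt_swap[of "fst z" "snd z" 2] by (intro image_eqI[of _ _ "prod.swap z"]) auto
    qed (auto simp: F1.C_lt_swap)
    finally have SC_swap: "S ` C = prod.swap ` (C_gt T1 T2 p q n' m' 2 \<inter> {0<..} \<times> {0<..})" .
    have "C \<noteq> {}"
      using curve(1) SC_swap by auto
    moreover have "hyperbolic_like C"
      by (rule hyp) (simp only: SC_swap curve(3))
    moreover have "C \<subseteq> fucik_spectrum_star T1 T2 p q m n"
    proof (rule spec)
      fix z assume "z \<in> S ` C"
      then obtain a b where "z = (b, a)" "(a, b) \<in> C_gt T1 T2 p q n' m' 2 \<inter> {0<..} \<times> {0<..}"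
        unfolding SC_swap by auto
      then show "z \<notin> C_gt T1 T2 p q m' n' 1 \<and> z \<notin> C_lt T1 T2 p q m' n' 1"
        using curve(4)[of a b] F1.C_lt_swap[of b a 1] F2.C_lt_swap[of a b 1] by simp
    qed (auto simp: C_def)
    ultimately show ?thesis
      unfolding C_def by blast
  qed
qed

theorem corollary3p7:
  fixes T1 T2 :: real and p q m n :: "real \<Rightarrow> real"
  assumes "T1 < T2"
    and "continuous_on {T1..T2} p" and "continuous_on {T1..T2} q"
    and "continuous_on {T1..T2} m" and "continuous_on {T1..T2} n"
    and "\<forall>t\<in>{T1..T2}. p t > 0" and "\<forall>t\<in>{T1..T2}. q t \<ge> 0"
    and "\<exists>t\<in>{T1..T2}. m t \<noteq> 0" and "\<exists>t\<in>{T1..T2}. n t \<noteq> 0"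
    and "changes_sign T1 T2 m" and "changes_sign T1 T2 n"
  shows "\<forall>Q \<in> {{0<..} \<times> {0<..}, {..<0} \<times> {..<0}, {0<..} \<times> {..<0}, {..<0} \<times> {0<..}}.
           \<exists>k\<ge>2. \<exists>C \<in> {C_gt T1 T2 p q m n k \<inter> Q, C_lt T1 T2 p q m n k \<inter> Q}.
             C \<noteq> {} \<and> hyperbolic_like C \<and> C \<subseteq> fucik_spectrum_star T1 T2 p q m n"
proof
  fix Q :: "(real \<times> real) set"
  assume "Q \<in> {{0<..} \<times> {0<..}, {..<0} \<times> {..<0}, {0<..} \<times> {..<0}, {..<0} \<times> {0<..}}"
  then have "Q \<in> {quadrant 1 1, quadrant (-1) (-1), quadrant 1 (-1), quadrant (-1) 1}"
    by (auto simp: quadrant_def)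
  then obtain \<sigma> \<tau> where sgn: "\<sigma> \<in> {1, -1}" "\<tau> \<in> {1, -1}" and Q: "Q = quadrant \<sigma> \<tau>"
    by blast
  have FP: "fucik_problem T1 T2 p q m n"
    using assms by unfold_locales auto
  have both_signs: "\<exists>t\<in>{T1<..<T2}. 0 < \<rho> * f t"
    if f: "changes_sign T1 T2 f" and \<rho>: "\<rho> \<in> {1, -1}" for \<rho> and f :: "real \<Rightarrow> real"
  proof -
    obtain r t where "r \<in> {T1<..<T2}" "max (f r) 0 \<noteq> 0" "t \<in> {T1<..<T2}" "max (- f t) 0 \<noteq> 0"
      using f unfolding changes_sign_def by blast
    then have "r \<in> {T1<..<T2}" "0 < f r" "t \<in> {T1<..<T2}" "f t < 0"
      by (auto simp: max_def split: if_splits)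
    then show ?thesis
      using \<rho> by auto
  qed
  show "\<exists>k\<ge>2. \<exists>C \<in> {C_gt T1 T2 p q m n k \<inter> Q, C_lt T1 T2 p q m n k \<inter> Q}.
             C \<noteq> {} \<and> hyperbolic_like C \<and> C \<subseteq> fucik_spectrum_star T1 T2 p q m n"
    unfolding Q
    using second_curve_in_quadrant[OF FP sgn both_signs[OF assms(10) sgn(1)] both_signs[OF assms(11) sgn(2)]]
    by (intro exI[of _ 2]) simp
qed

end
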